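(* There are positive constants $C_1,C_2$ such that, if $\nu$ is a (positive) Borel measure on $\overline{T}^2$, then $$C_1\sup_{n\ge1;\ \alpha_1,\dots,\alpha_n\in T^2}\frac{\nu\big(\bigcup_{j=1}^nS(\alpha_j)\big)}{\mathrm{Cap}\big(\bigcup_{j=1}^n\partial S(\alpha_j)\big)}\le\|\mathbb{I}\|^2_{\mathcal{B}(\ell^2(T^2),L^2(\nu))}\le C_2\sup_{n\ge1;\ \alpha_1,\dots,\alpha_n\in T^2}\frac{\nu\big(\bigcup_{j=1}^nS(\alpha_j)\big)}{\mathrm{Cap}\big(\bigcup_{j=1}^n\partial S(\alpha_j)\big)}.$$
   Context: $T$ is (the vertex set of) the infinite rooted binary tree with root $o$; $\partial T$ is the set of infinite descending sequences $\omega=(\omega^j)_{j\ge0}$, $\omega^0=o$, $\omega^{j+1}$ a child of $\omega^j$; $\overline{T}=T\cup\partial T$. For $\alpha,\beta\in T$, $\alpha\le\beta$ means that $\beta$ lies on the path from $o$ to $\alpha$; also $\omega\le\omega^j$ for all $j$ and $\omega\le\omega$ when $\omega\in\partial T$. $\overline{T}$ carries its compact metrizable topology given by the metric $\delta_0(\zeta,\xi)=2^{-d(\zeta\wedge\xi)}-\frac12(2^{-d(\zeta)}+2^{-d(\xi)})$, where $d(\zeta\wedge\xi)\in[1,\infty]$ is the number of common ancestors in $T$ of $\zeta,\xi$ (a vertex is its own ancestor) and $d(\zeta)=d(\zeta\wedge\zeta)$. $T^2=T\times T$, $\overline{T}^2=\overline{T}\times\overline{T}$, $(\partial T)^2=\partial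 T\times\partial T$, with product order and topology. For $\alpha\in T^2$: $S(\alpha)=\{\zeta\in\overline{T}^2:\zeta\le\alpha\}$ and $\partial S(\alpha)=S(\alpha)\cap(\partial T)^2$. For $\varphi:T^2\to[0,\infty)$ and $\zeta\in\overline{T}^2$, $\mathbb{I}\varphi(\zeta)=\sum_{\alpha\in T^2,\ \alpha\ge\zeta}\varphi(\alpha)$. $\|\mathbb{I}\|^2_{\mathcal{B}(\ell^2(T^2),L^2(\nu))}\in[0,\infty]$ is the smallest $C$ with $\int_{\overline{T}^2}(\mathbb{I}\varphi)^2d\nu\le C\sum_{\alpha\in T^2}\varphi(\alpha)^2$ for all $\varphi\ge0$. For $E\subseteq\overline{T}^2$, $\mathrm{Cap}(E)=\inf\{\|\varphi\|^2_{\ell^2(T^2)}:\varphi\ge0,\ \mathbb{I}\varphi(\zeta)\ge1\text{ for all }\zeta\in E\}$. *)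

theory Defs
  imports "HOL-Analysis.Analysis" "HOL-Library.Sublist"
begin

text \<open>
  A vertex of the rooted binary tree \<open>T\<close> is the list of left/right choices leading to it from
  the root \<open>[]\<close>; the children of \<open>v\<close> are \<open>v @ [False]\<close> and \<open>v @ [True]\<close>. A boundary point
  is the infinite sequence of choices \<open>w\<close>, which determines and is determined by the descending
  sequence of vertices \<open>desc w 0 = [], desc w 1, desc w 2, \<dots>\<close>.
\<close>

type_synonym vertex = "bool list"

datatype tbar = Vert vertex | Bdry "nat \<Rightarrow> bool"

definition desc :: "(nat \<Rightarrow> bool) \<Rightarrow> nat \<Rightarrow> vertex" where
  "desc w j = map w [0..<j]"

text \<open>The root is the largest element: smaller means further away from the root.\<close>

instantiation tbar :: order
begin

fun less_eq_tbar :: "tbar \<Rightarrow> tbar \<Rightarrow> bool" where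
  "less_eq_tbar (Vert a) (Vert b) = prefix b a"
| "less_eq_tbar (Bdry w) (Vert b) = (\<exists>j. b = desc w j)"
| "less_eq_tbar (Bdry w) (Bdry w') = (w = w')"
| "less_eq_tbar (Vert a) (Bdry w) = False"

definition less_tbar :: "tbar \<Rightarrow> tbar \<Rightarrow> bool" where
  "less_tbar x y = (x \<le> y \<and> \<not> y \<le> x)"

lemma prefix_desc_iff: "prefix b (desc w j) \<longleftrightarrow> (\<exists>i\<le>j. b = desc w i)"
proof
  assume "prefix b (desc w j)"
  then have "b = take (length b) (desc w j)" "length b \<le> j"
    by (auto simp: prefix_def desc_def dest: arg_cong[of _ _ length])
  then have "b = desc w (length b)"
    by (simp add: desc_def take_map)
  with \<open>length b \<le> j\<close> show "\<exists>i\<le>j. b = desc w i" by blast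
next
  assume "\<exists>i\<le>j. b = desc w i"
  then obtain i where "i \<le> j" "b = desc w i" by blast
  then have "b = take i (desc w j)" by (simp add: desc_def take_map)
  then show "prefix b (desc w j)" by (simp add: take_is_prefix)
qed

instance
proof
  fix x y z :: tbar
  show "(x < y) = (x \<le> y \<and> \<not> y \<le> x)" by (fact less_tbar_def)
  show "x \<le> x" by (cases x) auto
  show "x \<le> z" if "x \<le> y" "y \<le> z"
    using that by (cases x; cases y; cases z) (auto simp: prefix_desc_iff)
  show "x = y" if "x \<le> y" "y \<le> x"
    using that by (cases x; cases y) auto
qed

end

definition ancestors :: "tbar \<Rightarrow> vertex set" where
  "ancestors x = {v. x \<le> Vert v}"

text \<open>\<open>dmeet x y\<close> is \<open>d(x \<and> y)\<close>, and \<open>dmeet x x\<close> is \<open>d(x)\<close>.\<close>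

definition dmeet :: "tbar \<Rightarrow> tbar \<Rightarrow> enat" where
  "dmeet x y = (if finite (ancestors x \<inter> ancestors y)
                then enat (card (ancestors x \<inter> ancestors y)) else \<infinity>)"

definition two_pow_neg :: "enat \<Rightarrow> real" where
  "two_pow_neg n = (case n of enat k \<Rightarrow> 1 / 2 ^ k | \<infinity> \<Rightarrow> 0)"

definition delta0 :: "tbar \<Rightarrow> tbar \<Rightarrow> real" where
  "delta0 x y = two_pow_neg (dmeet x y) - 1/2 * (two_pow_neg (dmeet x x) + two_pow_neg (dmeet y y))"

lemma two_pow_neg_antimono: "m \<le> n \<Longrightarrow> two_pow_neg n \<le> two_pow_neg m"
  by (cases m; cases n) (auto simp: two_pow_neg_def field_simps)

lemma two_pow_neg_inj: "two_pow_neg m = two_pow_neg n \<Longrightarrow> m = n"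
  by (cases m; cases n) (auto simp: two_pow_neg_def field_simps)

lemma dmeet_mono:
  "ancestors x \<inter> ancestors y \<subseteq> ancestors x' \<inter> ancestors y' \<Longrightarrow> dmeet x y \<le> dmeet x' y'"
  using card_mono[of "ancestors x' \<inter> ancestors y'" "ancestors x \<inter> ancestors y"]
    finite_subset[of "ancestors x \<inter> ancestors y" "ancestors x' \<inter> ancestors y'"]
  by (simp add: dmeet_def del: Int_subset_iff)

lemma dmeet_commute: "dmeet x y = dmeet y x"
  by (simp add: dmeet_def Int_commute)

lemma ancestors_Vert: "ancestors (Vert a) = {v. prefix v a}"
  by (simp add: ancestors_def)

lemma ancestors_Bdry: "ancestors (Bdry w) = range (desc w)"
  by (auto simp: ancestors_def)

lemma finite_ancestors_Vert: "finite (ancestors (Vert a))"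
proof -
  have "ancestors (Vert a) = set (prefixes a)"
    by (auto simp: ancestors_Vert)
  then show ?thesis by simp
qed

lemma length_desc [simp]: "length (desc w j) = j"
  by (simp add: desc_def)

lemma desc_eq_imp: "desc w j = desc w' j \<Longrightarrow> i < j \<Longrightarrow> w i = w' i"
  by (auto simp: desc_def)

lemma infinite_ancestors_Bdry: "infinite (ancestors (Bdry w))"
proof -
  have "inj (desc w)" by (metis injI length_desc)
  then show ?thesis by (simp add: ancestors_Bdry finite_image_iff)
qed

lemma ancestors_prefix_closed:
  "v \<in> ancestors x \<Longrightarrow> prefix u v \<Longrightarrow> u \<in> ancestors x"
  using order_trans[of x "Vert v" "Vert u"] by (simp add: ancestors_def)

lemma ancestors_chain:
  "u \<in> ancestors x \<Longrightarrow> v \<in> ancestors x \<Longrightarrow> prefix u v \<or> prefix v u"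
proof (cases x)
  case (Vert a)
  then show "u \<in> ancestors x \<Longrightarrow> v \<in> ancestors x \<Longrightarrow> prefix u v \<or> prefix v u"
    using prefix_same_cases by (auto simp: ancestors_Vert)
next
  case (Bdry w)
  then show "u \<in> ancestors x \<Longrightarrow> v \<in> ancestors x \<Longrightarrow> prefix u v \<or> prefix v u"
    by (auto simp: ancestors_Bdry prefix_desc_iff) (metis nle_le)
qed

lemma dmeet_eq_imp_eq:
  assumes 1: "dmeet x y = dmeet x x" and 2: "dmeet x y = dmeet y y"
  shows "x = y"
proof (cases "finite (ancestors x) \<or> finite (ancestors y)")
  case True
  have fx: "finite (ancestors x)" and fy: "finite (ancestors y)"
    using True 1 2 by (auto simp: dmeet_def split: if_splits)
  then have c: "card (ancestors x \<inter> ancestors y) = card (ancestors x)"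
    "card (ancestors x \<inter> ancestors y) = card (ancestors y)"
    using 1 2 by (auto simp: dmeet_def)
  have "ancestors x \<inter> ancestors y = ancestors x" "ancestors x \<inter> ancestors y = ancestors y"
    using card_subset_eq[OF fx _ c(1)] card_subset_eq[OF fy _ c(2)] by auto
  then have eq: "ancestors x = ancestors y" by simp
  obtain a b where "x = Vert a" "y = Vert b"
    using fx fy infinite_ancestors_Bdry by (metis tbar.exhaust)
  with eq show ?thesis
    by (auto simp: ancestors_Vert set_eq_iff) (metis prefix_order.order_antisym prefix_order.order_refl)
next
  case False
  then obtain w w' where xy: "x = Bdry w" "y = Bdry w'"
    using finite_ancestors_Vert by (metis tbar.exhaust)
  have inf: "infinite (ancestors x \<inter> ancestors y)"
    using 1 False by (auto simp: dmeet_def split: if_splits)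
  have "w i = w' i" for i
  proof (rule ccontr)
    assume ne: "w i \<noteq> w' i"
    have "ancestors x \<inter> ancestors y \<subseteq> desc w ` {..i}"
    proof
      fix v assume "v \<in> ancestors x \<inter> ancestors y"
      then obtain j j' where "v = desc w j" "v = desc w' j'"
        unfolding xy ancestors_Bdry by blast
      moreover from this have "j = j'" by (metis length_desc)
      ultimately show "v \<in> desc w ` {..i}"
        using ne desc_eq_imp[of w j w' i] by (metis atMost_iff image_eqI not_le_imp_less)
    qed
    then show False using inf finite_subset by blast
  qed
  then show ?thesis by (auto simp: xy)
qed

lemma delta0_triangle: "delta0 x y \<le> delta0 x z + delta0 y z"
proof -
  let ?A = "ancestors x \<inter> ancestors z" and ?B = "ancestors y \<inter> ancestors z"
  have "?A \<subseteq> ?B \<or> ?B \<subseteq> ?A"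
  proof (rule ccontr)
    assume "\<not> (?A \<subseteq> ?B \<or> ?B \<subseteq> ?A)"
    then obtain u v where "u \<in> ?A" "u \<notin> ?B" "v \<in> ?B" "v \<notin> ?A" by blast
    then show False
      using ancestors_chain[of u z v] ancestors_prefix_closed by blast
  qed
  then have "dmeet x z \<le> dmeet x y \<or> dmeet y z \<le> dmeet x y"
    by (auto intro!: dmeet_mono)
  then have "two_pow_neg (dmeet x y) \<le> two_pow_neg (dmeet x z) \<or>
      two_pow_neg (dmeet x y) \<le> two_pow_neg (dmeet y z)"
    using two_pow_neg_antimono by blast
  moreover have "two_pow_neg (dmeet z z) \<le> two_pow_neg (dmeet x z)"
    "two_pow_neg (dmeet z z) \<le> two_pow_neg (dmeet y z)"
    by (auto intro!: two_pow_neg_antimono dmeet_mono)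
  ultimately show ?thesis by (auto simp: delta0_def field_simps)
qed

lemma delta0_eq_0_iff: "delta0 x y = 0 \<longleftrightarrow> x = y"
proof
  assume "delta0 x y = 0"
  moreover have "two_pow_neg (dmeet x x) \<le> two_pow_neg (dmeet x y)"
    "two_pow_neg (dmeet y y) \<le> two_pow_neg (dmeet x y)"
    by (auto intro!: two_pow_neg_antimono dmeet_mono)
  ultimately have "two_pow_neg (dmeet x y) = two_pow_neg (dmeet x x)"
    "two_pow_neg (dmeet x y) = two_pow_neg (dmeet y y)"
    by (auto simp: delta0_def)
  then show "x = y" using dmeet_eq_imp_eq two_pow_neg_inj by blast
qed (simp add: delta0_def)

instantiation tbar :: metric_space
begin

definition dist_tbar :: "tbar \<Rightarrow> tbar \<Rightarrow> real" where
  "dist_tbar = delta0"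

definition uniformity_tbar :: "(tbar \<times> tbar) filter" where
  "uniformity_tbar = (INF e\<in>{0<..}. principal {(x, y). dist x y < e})"

definition open_tbar :: "tbar set \<Rightarrow> bool" where
  "open_tbar U = (\<forall>x\<in>U. eventually (\<lambda>(x', y). x' = x \<longrightarrow> y \<in> U) uniformity)"

instance
proof
  fix x y z :: tbar and U :: "tbar set"
  show "uniformity = (INF e\<in>{0<..}. principal {(x::tbar, y). dist x y < e})"
    by (fact uniformity_tbar_def)
  show "open U = (\<forall>x\<in>U. eventually (\<lambda>(x', y). x' = x \<longrightarrow> y \<in> U) uniformity)"
    by (fact open_tbar_def)
  show "dist x y = 0 \<longleftrightarrow> x = y" by (simp add: dist_tbar_def delta0_eq_0_iff)
  show "dist x y \<le> dist x z + dist y z" by (simp add: dist_tbar_def delta0_triangle)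
qed

end

text \<open>On \<open>tbar \<times> tbar\<close>, \<open>\<le>\<close> is the componentwise order of the product type.\<close>

definition emb2 :: "vertex \<times> vertex \<Rightarrow> tbar \<times> tbar" where
  "emb2 = map_prod Vert Vert"

definition Sset :: "vertex \<times> vertex \<Rightarrow> (tbar \<times> tbar) set" where
  "Sset \<alpha> = {\<zeta>. \<zeta> \<le> emb2 \<alpha>}"

definition bdSset :: "vertex \<times> vertex \<Rightarrow> (tbar \<times> tbar) set" where
  "bdSset \<alpha> = Sset \<alpha> \<inter> (range Bdry \<times> range Bdry)"

definition Iop :: "(vertex \<times> vertex \<Rightarrow> real) \<Rightarrow> tbar \<times> tbar \<Rightarrow> ennreal" where
  "Iop \<phi> \<zeta> = (\<Sum>\<^sub>\<infinity>\<alpha>\<in>{\<alpha>. \<zeta> \<le> emb2 \<alpha>}. ennreal (\<phi> \<alpha>))"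

definition l2_norm_sq :: "(vertex \<times> vertex \<Rightarrow> real) \<Rightarrow> ennreal" where
  "l2_norm_sq \<phi> = (\<Sum>\<^sub>\<infinity>\<alpha>. ennreal ((\<phi> \<alpha>)\<^sup>2))"

text \<open>
  The infimum over \<open>[0, \<infinity>]\<close> is attained. The convention \<open>0 * \<infinity> = 0\<close> is harmless: \<open>C = 0\<close> is
  admissible only for the zero measure, by testing with the indicator of the pair of roots.
\<close>

definition I_norm_sq :: "(tbar \<times> tbar) measure \<Rightarrow> ennreal" where
  "I_norm_sq \<nu> = Inf {C. \<forall>\<phi>. (\<forall>\<alpha>. 0 \<le> \<phi> \<alpha>) \<longrightarrow>
                          (\<integral>\<^sup>+\<zeta>. (Iop \<phi> \<zeta>)\<^sup>2 \<partial>\<nu>) \<le> C * l2_norm_sq \<phi>}"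

definition Cap :: "(tbar \<times> tbar) set \<Rightarrow> ennreal" where
  "Cap E = (INF \<phi>\<in>{\<phi>. (\<forall>\<alpha>. 0 \<le> \<phi> \<alpha>) \<and> (\<forall>\<zeta>\<in>E. 1 \<le> Iop \<phi> \<zeta>)}. l2_norm_sq \<phi>)"

text \<open>
  The quotients below never involve \<open>0\<close> or \<open>\<infinity>\<close> in the denominator: the capacity of a nonempty
  finite union of sets \<open>bdSset \<alpha>\<close> lies strictly between \<open>0\<close> and \<open>\<infinity>\<close>.
\<close>

definition cap_sup :: "(tbar \<times> tbar) measure \<Rightarrow> ennreal" where
  "cap_sup \<nu> = (SUP (n, \<alpha>)\<in>{(n::nat, \<alpha>::nat \<Rightarrow> vertex \<times> vertex). 1 \<le> n}.
      emeasure \<nu> (\<Union>j\<in>{1..n}. Sset (\<alpha> j)) / Cap (\<Union>j\<in>{1..n}. bdSset (\<alpha> j)))"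

end

theory Submission imports Defs begin

text \<open>
  Write \<open>I\<close> for the Hardy operator of the bitree and \<open>I*\<close> for its adjoint, so that \<open>I* \<mu>\<close> is the
  mass below a point and \<open>V = I (I* \<mu>)\<close> is the potential of \<open>\<mu>\<close>.

  The lower bound for the norm comes from testing the embedding on near-extremal functions for the
  capacity. Such a function \<open>\<phi>\<close> is known to have \<open>I \<phi> \<ge> 1\<close> only at boundary points. It is replaced
  by the function \<open>\<psi>\<close> that adds to \<open>\<phi>\<close> at each vertex pair the values at all pairs of descendants,
  weighted by the probability that random descending paths go through them. This is a bounded
  operation on square-summable functions (\<open>smear2_l2\<close>), and \<open>I \<psi>\<close> at a vertex pair is at least the
  expectation of \<open>I \<phi>\<close> at a random boundary point below it, which is at least 1
  (\<open>transfer_to_interior\<close>).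

  The upper bound follows from the strong capacitary inequality: the capacities of the level sets
  \<open>{I \<phi> \<ge> \<lambda>}\<close>, weighted by \<open>\<lambda>\<^sup>2\<close> and summed over a geometric progression of levels \<open>\<lambda>\<close>, are
  bounded by the square of the norm of \<open>\<phi>\<close>. After truncation to finitely many generations, level
  sets are finite unions of rectangles, so the capacitary condition turns this inequality into the
  embedding, and monotone convergence removes the truncation.

  For the capacitary inequality, let \<open>\<mu>\<^sub>k\<close> be the equilibrium charges of the level sets. Duality
  reduces the claim to almost orthogonality of the functions \<open>I* \<mu>\<^sub>k\<close>, that is, to bounds for the
  integral of the potential of \<open>\<mu>\<^sub>j\<close> against \<open>\<mu>\<^sub>k\<close> for \<open>j \<le> k\<close>. On a tree the potential of an
  equilibrium measure is at most 1 everywhere, which gives such bounds at once. On the bitree it is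
  in general at most 1 on the support only. However, with \<open>f = I* \<mu>\<close> and \<open>g\<close> the product of the two one-parameter
  sums of \<open>f\<close>, one has \<open>V\<^sup>2 \<le> 2 V + 2 I g\<close> (\<open>hardy_square_le\<close>) and the norm of \<open>g\<close> is at most twice that
  of \<open>f\<close> (\<open>sq_norm_g\<close>). So the set where \<open>V > T\<close> has a small capacity, of order \<open>T\<close> to the power -4
  times the mass of \<open>\<mu>\<close>, and this weak form of the maximum principle (\<open>mutual_energy\<close>) suffices.
\<close>

section \<open>Potential theory on a finite bitree\<close>

definition below :: "vertex \<Rightarrow> vertex \<Rightarrow> real" where
  "below u x = of_bool (prefix u x)"

lemma below_nonneg [simp]: "0 \<le> below u x"
  and below_refl [simp]: "below x x = 1"
  by (auto simp: below_def)

lemma below_trans: "below u x * below x a \<le> below u a * below x a"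
  by (auto simp: below_def dest: prefix_order.trans)

text \<open>
  The ancestors of a vertex form a chain, so every pair of them is counted by one of the two
  products on the right.
\<close>

lemma below_chain:
  "below u x * below u' x \<le> below u u' * below u' x + below u' u * below u x"
  by (auto simp: below_def dest: prefix_same_cases)

text \<open>
  On a finite set \<open>A\<close> of vertices, \<open>hardy A\<close> is the two-parameter Hardy operator restricted to
  \<open>A \<times> A\<close>, \<open>hardy1 A\<close> and \<open>hardy2 A\<close> are its one-parameter factors, and \<open>adjoint A\<close> is its adjoint: for a
  charge \<open>\<mu>\<close>, \<open>adjoint A \<mu> x y\<close> is the mass below \<open>(x, y)\<close> and \<open>hardy A (adjoint A \<mu>)\<close> is the potential
  of \<open>\<mu>\<close>. Everything is written with the 0/1 kernel \<open>below\<close> and sums over all of \<open>A\<close>, so that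
  interchanging sums needs no side conditions.
\<close>

definition adjoint :: "vertex set \<Rightarrow> (vertex \<Rightarrow> vertex \<Rightarrow> real) \<Rightarrow> vertex \<Rightarrow> vertex \<Rightarrow> real" where
  "adjoint A \<mu> x y = (\<Sum>a\<in>A. \<Sum>b\<in>A. below x a * below y b * \<mu> a b)"

definition hardy1 :: "vertex set \<Rightarrow> (vertex \<Rightarrow> vertex \<Rightarrow> real) \<Rightarrow> vertex \<Rightarrow> vertex \<Rightarrow> real" where
  "hardy1 A f x y = (\<Sum>u\<in>A. below u x * f u y)"

definition hardy2 :: "vertex set \<Rightarrow> (vertex \<Rightarrow> vertex \<Rightarrow> real) \<Rightarrow> vertex \<Rightarrow> vertex \<Rightarrow> real" where
  "hardy2 A f x y = (\<Sum>v\<in>A. below v y * f x v)"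

definition hardy :: "vertex set \<Rightarrow> (vertex \<Rightarrow> vertex \<Rightarrow> real) \<Rightarrow> vertex \<Rightarrow> vertex \<Rightarrow> real" where
  "hardy A f x y = (\<Sum>u\<in>A. \<Sum>v\<in>A. below u x * below v y * f u v)"

definition sq_norm :: "vertex set \<Rightarrow> (vertex \<Rightarrow> vertex \<Rightarrow> real) \<Rightarrow> real" where
  "sq_norm A f = (\<Sum>x\<in>A. \<Sum>y\<in>A. (f x y)\<^sup>2)"

lemma hardy_eq_hardy1: "hardy A f x y = (\<Sum>v\<in>A. below v y * hardy1 A f x v)"
  unfolding hardy_def hardy1_def sum_distrib_left by (subst sum.swap) (simp add: mult_ac)

lemma adjoint_swap: "adjoint A (\<lambda>a b. \<mu> b a) x y = adjoint A \<mu> y x"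
  unfolding adjoint_def by (subst sum.swap) (simp add: mult_ac)

lemma hardy_swap: "hardy A (\<lambda>a b. f b a) x y = hardy A f y x"
  unfolding hardy_def by (subst sum.swap) (simp add: mult_ac)

lemma adjoint_nonneg: "(\<And>a b. 0 \<le> \<mu> a b) \<Longrightarrow> 0 \<le> adjoint A \<mu> x y"
  and hardy1_nonneg: "(\<And>a b. 0 \<le> f a b) \<Longrightarrow> 0 \<le> hardy1 A f x y"
  and hardy2_nonneg: "(\<And>a b. 0 \<le> f a b) \<Longrightarrow> 0 \<le> hardy2 A f x y"
  and hardy_nonneg: "(\<And>a b. 0 \<le> f a b) \<Longrightarrow> 0 \<le> hardy A f x y"
  by (auto simp: adjoint_def hardy1_def hardy2_def hardy_def intro!: sum_nonneg)

text \<open>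
  Potentials increase towards the leaves. Multiplying by the kernel turns this into an inequality
  that can be summed over all \<open>a\<close> and \<open>b\<close>.
\<close>

lemma hardy_antimono:
  assumes "\<And>a b. 0 \<le> f a b"
  shows "below x a * below y b * hardy A f x y \<le> below x a * below y b * hardy A f a b"
  unfolding hardy_def sum_distrib_left
proof (intro sum_mono)
  fix u v
  have "(below u x * below x a) * (below v y * below y b) \<le> (below u a * below x a) * (below v b * below y b)"
    by (intro mult_mono below_trans) auto
  from mult_right_mono[OF this assms[of u v]]
  show "below x a * below y b * (below u x * below v y * f u v) \<le> below x a * below y b * (below u a * below v b * f u v)"
    by (simp add: mult_ac)
qed

text \<open>
  A charge whose potential is at most 1 on its support, as for an equilibrium measure. Stating the
  condition as the product inequality \<open>compl\<close> avoids any mention of the support.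

  Off the support the potential may be large, because two-parameter potentials do not obey a
  maximum principle. What survives is that \<open>f\<close> charges only points lying above the support,
  and there the potential is at most 1 (\<open>f_hardy_le\<close>).
\<close>

locale charge =
  fixes A :: "vertex set" and \<mu> :: "vertex \<Rightarrow> vertex \<Rightarrow> real"
  assumes nonneg: "\<And>a b. 0 \<le> \<mu> a b"
    and compl: "\<And>a b. a \<in> A \<Longrightarrow> b \<in> A \<Longrightarrow> \<mu> a b * hardy A (adjoint A \<mu>) a b \<le> \<mu> a b"
begin

abbreviation "f \<equiv> adjoint A \<mu>"

lemma f_nonneg [simp]: "0 \<le> f x y"
  by (rule adjoint_nonneg[OF nonneg])

lemma swap: "charge A (\<lambda>a b. \<mu> b a)"
proof
  have *: "adjoint A (\<lambda>a b. \<mu> b a) = (\<lambda>a b. f b a)"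
    by (intro ext adjoint_swap)
  show "\<mu> b a * hardy A (adjoint A (\<lambda>a b. \<mu> b a)) a b \<le> \<mu> b a" if "a \<in> A" "b \<in> A" for a b
    unfolding * hardy_swap[of A "adjoint A \<mu>"] using compl that by blast
qed (rule nonneg)

lemma weighted_compl:
  assumes "a \<in> A" "b \<in> A"
  shows "\<mu> a b * (below x a * below y b * hardy A f x y) \<le> below x a * below y b * \<mu> a b"
proof -
  have "\<mu> a b * (below x a * below y b * hardy A f x y) \<le> \<mu> a b * (below x a * below y b * hardy A f a b)"
    by (intro mult_left_mono hardy_antimono nonneg) auto
  also have "\<dots> = below x a * below y b * (\<mu> a b * hardy A f a b)" by (simp add: mult_ac)
  also have "\<dots> \<le> below x a * below y b * \<mu> a b"
    by (intro mult_left_mono compl assms) auto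
  finally show ?thesis .
qed

lemma f_hardy_le: "f x y * hardy A f x y \<le> f x y"
proof -
  have "f x y * hardy A f x y = (\<Sum>a\<in>A. \<Sum>b\<in>A. \<mu> a b * (below x a * below y b * hardy A f x y))"
    unfolding adjoint_def[of A \<mu> x y] sum_distrib_right by (simp add: mult_ac)
  also have "\<dots> \<le> f x y"
    unfolding adjoint_def[of A \<mu> x y] by (intro sum_mono weighted_compl)
  finally show ?thesis .
qed

text \<open>
  Expand \<open>f x y\<close> as the mass below \<open>(x, y)\<close>. A mass point \<open>(a, b)\<close> then meets the sum of
  \<open>hardy1 A f x y\<close> over the ancestors \<open>y\<close> of \<open>b\<close> between \<open>b\<close> and \<open>y'\<close>, which is at most the potential
  at \<open>(x, b)\<close> and hence at most 1. So a sum over arbitrarily many generations of descendants is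
  absorbed at no cost.
\<close>

lemma absorb2: "(\<Sum>y\<in>A. below y' y * (f x y * hardy1 A f x y)) \<le> f x y'"
proof -
  have "(\<Sum>y\<in>A. below y' y * (f x y * hardy1 A f x y))
      = (\<Sum>y\<in>A. \<Sum>a\<in>A. \<Sum>b\<in>A. \<mu> a b * below x a * (below y' y * below y b * hardy1 A f x y))"
    unfolding adjoint_def[of A \<mu> x] by (simp add: sum_distrib_left sum_distrib_right mult_ac)
  also have "\<dots> = (\<Sum>a\<in>A. \<Sum>b\<in>A. \<Sum>y\<in>A. \<mu> a b * below x a * (below y' y * below y b * hardy1 A f x y))"
    by (subst sum.swap, rule sum.cong[OF refl], rule sum.swap)
  also have "\<dots> \<le> (\<Sum>a\<in>A. \<Sum>b\<in>A. \<Sum>y\<in>A. \<mu> a b * below x a * (below y' b * below y b * hardy1 A f x y))"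
    by (intro sum_mono mult_left_mono mult_right_mono below_trans hardy1_nonneg mult_nonneg_nonneg nonneg) auto
  also have "\<dots> = (\<Sum>a\<in>A. \<Sum>b\<in>A. \<mu> a b * (below x a * below y' b * hardy A f x b))"
    unfolding hardy_eq_hardy1 by (simp add: sum_distrib_left mult_ac)
  also have "\<dots> \<le> (\<Sum>a\<in>A. \<Sum>b\<in>A. below x a * below y' b * \<mu> a b)"
  proof (intro sum_mono)
    fix a b assume ab: "a \<in> A" "b \<in> A"
    have "\<mu> a b * (below x a * hardy A f x b) \<le> below x a * \<mu> a b"
      using weighted_compl[OF ab, of x b] by simp
    from mult_left_mono[OF this, of "below y' b"]
    show "\<mu> a b * (below x a * below y' b * hardy A f x b) \<le> below x a * below y' b * \<mu> a b"
      by (simp add: mult_ac)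
  qed
  finally show ?thesis unfolding adjoint_def[of A \<mu> x y'] .
qed

lemma absorb1: "(\<Sum>x\<in>A. below x' x * (f x y * hardy2 A f x y)) \<le> f x' y"
proof -
  have *: "adjoint A (\<lambda>a b. \<mu> b a) = (\<lambda>a b. adjoint A \<mu> b a)"
    by (intro ext adjoint_swap)
  show ?thesis
    using charge.absorb2[OF swap, of x' y] unfolding * hardy1_def hardy2_def .
qed

end

text \<open>
  In the square of a sum along a chain, each pair is counted at its lower element.
\<close>

lemma chain_square:
  assumes "\<And>u. 0 \<le> h u"
  shows "(\<Sum>u\<in>A. below u x * h u)\<^sup>2 \<le> 2 * (\<Sum>u'\<in>A. below u' x * (h u' * (\<Sum>u\<in>A. below u u' * h u)))"
proof -
  have "(\<Sum>u\<in>A. below u x * h u)\<^sup>2 = (\<Sum>u\<in>A. \<Sum>u'\<in>A. below u x * below u' x * (h u * h u'))"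
    unfolding power2_eq_square sum_product by (simp add: mult_ac)
  also have "\<dots> \<le> (\<Sum>u\<in>A. \<Sum>u'\<in>A. (below u u' * below u' x + below u' u * below u x) * (h u * h u'))"
    by (intro sum_mono mult_right_mono below_chain mult_nonneg_nonneg assms)
  also have "\<dots> = (\<Sum>u\<in>A. \<Sum>u'\<in>A. below u u' * below u' x * (h u * h u')) + (\<Sum>u\<in>A. \<Sum>u'\<in>A. below u' u * below u x * (h u * h u'))"
    by (simp add: distrib_right sum.distrib)
  also have "(\<Sum>u\<in>A. \<Sum>u'\<in>A. below u u' * below u' x * (h u * h u')) = (\<Sum>u\<in>A. \<Sum>u'\<in>A. below u' u * below u x * (h u * h u'))"
    by (subst sum.swap) (simp add: mult_ac)
  finally show ?thesis by (simp add: sum_distrib_left mult_ac)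
qed

text \<open>
  The square is a sum over pairs of ancestors \<open>(u, v)\<close>, \<open>(u', v')\<close> of \<open>(x, y)\<close>. If the pair is
  comparable, summing over the upper element gives the potential at the lower one. If it is
  ordered oppositely in the two coordinates, its meet is \<open>(u, v')\<close> or \<open>(u', v)\<close>, and summing over
  all pairs with a given meet gives the product of the two one-parameter sums there.
\<close>

lemma hardy_square:
  assumes f: "\<And>u v. 0 \<le> f u v"
  shows "(hardy A f x y)\<^sup>2 \<le> 2 * hardy A (\<lambda>u v. f u v * hardy A f u v) x y + 2 * hardy A (\<lambda>u v. hardy1 A f u v * hardy2 A f u v) x y"
proof -
  let ?c = "\<lambda>u u' x. below u u' * below u' x"
  let ?S = "\<lambda>k. \<Sum>u\<in>A. \<Sum>v\<in>A. \<Sum>u'\<in>A. \<Sum>v'\<in>A. k u v u' v' * (f u v * f u' v')"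
  have sw: "?S k = ?S (\<lambda>u v u' v'. k u' v' u v)" for k
  proof -
    have "?S k = (\<Sum>p\<in>A\<times>A. \<Sum>q\<in>A\<times>A. k (fst p) (snd p) (fst q) (snd q) * (f (fst p) (snd p) * f (fst q) (snd q)))"
      by (simp add: sum.cartesian_product')
    also have "\<dots> = (\<Sum>q\<in>A\<times>A. \<Sum>p\<in>A\<times>A. k (fst p) (snd p) (fst q) (snd q) * (f (fst p) (snd p) * f (fst q) (snd q)))"
      by (rule sum.swap)
    also have "\<dots> = ?S (\<lambda>u v u' v'. k u' v' u v)"
      by (simp add: sum.cartesian_product' mult_ac)
    finally show ?thesis .
  qed
  have "(hardy A f x y)\<^sup>2 = (\<Sum>p\<in>A\<times>A. below (fst p) x * below (snd p) y * f (fst p) (snd p))\<^sup>2"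
    unfolding hardy_def by (simp add: sum.cartesian_product')
  also have "\<dots> = ?S (\<lambda>u v u' v'. (below u x * below u' x) * (below v y * below v' y))"
    unfolding power2_eq_square sum_product by (simp add: sum.cartesian_product' mult_ac)
  also have "\<dots> \<le> ?S (\<lambda>u v u' v'. (?c u u' x + ?c u' u x) * (?c v v' y + ?c v' v y))"
    by (intro sum_mono mult_right_mono mult_mono below_chain mult_nonneg_nonneg f add_nonneg_nonneg) auto
  also have "\<dots> = ?S (\<lambda>u v u' v'. ?c u u' x * ?c v v' y) + ?S (\<lambda>u v u' v'. ?c u u' x * ?c v' v y)
      + ?S (\<lambda>u v u' v'. ?c u' u x * ?c v v' y) + ?S (\<lambda>u v u' v'. ?c u' u x * ?c v' v y)"
    by (simp add: distrib_right distrib_left sum.distrib)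
  also have "?S (\<lambda>u v u' v'. ?c u u' x * ?c v v' y) = ?S (\<lambda>u v u' v'. ?c u' u x * ?c v' v y)"
    by (rule sw)
  also have "?S (\<lambda>u v u' v'. ?c u u' x * ?c v' v y) = ?S (\<lambda>u v u' v'. ?c u' u x * ?c v v' y)"
    by (rule sw)
  also have "?S (\<lambda>u v u' v'. ?c u' u x * ?c v' v y) = hardy A (\<lambda>u v. f u v * hardy A f u v) x y"
    unfolding hardy_def by (simp add: sum_distrib_left mult_ac)
  also have "?S (\<lambda>u v u' v'. ?c u' u x * ?c v v' y) = (\<Sum>u\<in>A. \<Sum>v'\<in>A. \<Sum>v\<in>A. \<Sum>u'\<in>A. ?c u' u x * ?c v v' y * (f u v * f u' v'))"
    by (rule sum.cong[OF refl], subst (2) sum.swap, subst sum.swap, rule sum.cong[OF refl], rule sum.cong[OF refl], simp)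
  also have "\<dots> = hardy A (\<lambda>u v. hardy1 A f u v * hardy2 A f u v) x y"
  proof -
    have g: "hardy1 A f u v' * hardy2 A f u v' = (\<Sum>v\<in>A. \<Sum>u'\<in>A. below u' u * below v v' * (f u v * f u' v'))" for u v'
      unfolding hardy1_def hardy2_def sum_product by (subst sum.swap) (simp add: mult_ac)
    show ?thesis unfolding hardy_def g by (simp add: sum_distrib_left mult_ac)
  qed
  finally show ?thesis by simp
qed

context charge begin

text \<open>
  The correction term: since \<open>hardy A f\<close> cannot be bounded off the support, its square is controlled
  by \<open>hardy A g\<close>, and \<open>g\<close> is no larger in norm than \<open>f\<close>.
\<close>

abbreviation "g \<equiv> \<lambda>x y. hardy1 A f x y * hardy2 A f x y"

lemma hardy_square_le: "(hardy A f x y)\<^sup>2 \<le> 2 * hardy A f x y + 2 * hardy A g x y"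
proof -
  have "hardy A (\<lambda>u v. f u v * hardy A f u v) x y \<le> hardy A f x y"
    unfolding hardy_def[of A "\<lambda>u v. f u v * hardy A f u v"] hardy_def[of A f x y]
    by (intro sum_mono mult_left_mono f_hardy_le) auto
  with hardy_square[of f A x y] show ?thesis by simp
qed

text \<open>
  Apply \<open>chain_square\<close> to both factors of \<open>g\<close>, then absorb the sums over \<open>x\<close> and \<open>y\<close> in turn:
  \<open>absorb1\<close> leaves the sum of \<open>f * hardy1 A f * hardy2 A f\<close>, and \<open>absorb2\<close> reduces it to the sum of
  squares of \<open>f\<close>.
\<close>

lemma sq_norm_g: "sq_norm A g \<le> 4 * sq_norm A f"
proof -
  let ?p = "\<lambda>x y. f x y * hardy1 A f x y" and ?q = "\<lambda>x y. f x y * hardy2 A f x y"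
  have nn: "0 \<le> ?p x y" "0 \<le> ?q x y" "0 \<le> hardy1 A f x y" "0 \<le> hardy2 A f x y" for x y
    by (auto intro!: hardy1_nonneg hardy2_nonneg mult_nonneg_nonneg)
  have sq1: "(hardy1 A f x y)\<^sup>2 \<le> 2 * hardy1 A ?p x y" for x y
    using chain_square[of "\<lambda>u. f u y" x A] by (simp add: hardy1_def)
  have sq2: "(hardy2 A f x y)\<^sup>2 \<le> 2 * hardy2 A ?q x y" for x y
    using chain_square[of "\<lambda>v. f x v" y A] by (simp add: hardy2_def)
  have "sq_norm A g \<le> (\<Sum>x\<in>A. \<Sum>y\<in>A. (2 * hardy1 A ?p x y) * (2 * hardy2 A ?q x y))"
    unfolding sq_norm_def power_mult_distrib
    by (intro sum_mono mult_mono sq1 sq2) (auto intro!: hardy1_nonneg nn)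
  also have "\<dots> = 4 * (\<Sum>x\<in>A. \<Sum>y\<in>A. \<Sum>x'\<in>A. \<Sum>y'\<in>A. below x' x * below y' y * (?p x' y * ?q x y'))"
  proof -
    have "hardy1 A ?p x y * hardy2 A ?q x y = (\<Sum>x'\<in>A. \<Sum>y'\<in>A. below x' x * below y' y * (?p x' y * ?q x y'))" for x y
      unfolding hardy1_def[of A ?p] hardy2_def[of A ?q] sum_product by (simp add: mult_ac)
    from this[symmetric] show ?thesis by (simp add: sum_distrib_left)
  qed
  also have "(\<Sum>x\<in>A. \<Sum>y\<in>A. \<Sum>x'\<in>A. \<Sum>y'\<in>A. below x' x * below y' y * (?p x' y * ?q x y'))
     = (\<Sum>y\<in>A. \<Sum>x'\<in>A. \<Sum>y'\<in>A. \<Sum>x\<in>A. below x' x * below y' y * (?p x' y * ?q x y'))"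
    by (subst sum.swap, rule sum.cong[OF refl], subst sum.swap, rule sum.cong[OF refl], rule sum.swap)
  also have "\<dots> = (\<Sum>y\<in>A. \<Sum>x'\<in>A. \<Sum>y'\<in>A. below y' y * ?p x' y * (\<Sum>x\<in>A. below x' x * ?q x y'))"
    by (simp add: sum_distrib_left mult_ac)
  also have "\<dots> \<le> (\<Sum>y\<in>A. \<Sum>x'\<in>A. \<Sum>y'\<in>A. below y' y * ?p x' y * f x' y')"
    by (intro sum_mono mult_left_mono absorb1 mult_nonneg_nonneg nn) auto
  also have "\<dots> = (\<Sum>x'\<in>A. \<Sum>y'\<in>A. f x' y' * (\<Sum>y\<in>A. below y' y * ?p x' y))"
    by (subst sum.swap, rule sum.cong[OF refl], subst sum.swap, rule sum.cong[OF refl], simp add: sum_distrib_left mult_ac)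
  also have "\<dots> \<le> (\<Sum>x'\<in>A. \<Sum>y'\<in>A. f x' y' * f x' y')"
    by (intro sum_mono mult_left_mono absorb2) auto
  finally show ?thesis by (simp add: sq_norm_def power2_eq_square)
qed

end

definition mass :: "vertex set \<Rightarrow> (vertex \<Rightarrow> vertex \<Rightarrow> real) \<Rightarrow> real" where
  "mass A \<mu> = (\<Sum>x\<in>A. \<Sum>y\<in>A. \<mu> x y)"

lemma duality: "(\<Sum>a\<in>A. \<Sum>b\<in>A. \<mu> a b * hardy A \<phi> a b) = (\<Sum>u\<in>A. \<Sum>v\<in>A. \<phi> u v * adjoint A \<mu> u v)"
proof -
  have "(\<Sum>a\<in>A. \<Sum>b\<in>A. \<mu> a b * hardy A \<phi> a b)
      = (\<Sum>p\<in>A\<times>A. \<Sum>q\<in>A\<times>A. below (fst q) (fst p) * below (snd q) (snd p) * \<mu> (fst p) (snd p) * \<phi> (fst q) (snd q))"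
    unfolding hardy_def by (simp add: sum.cartesian_product' sum_distrib_left mult_ac)
  also have "\<dots> = (\<Sum>q\<in>A\<times>A. \<Sum>p\<in>A\<times>A. below (fst q) (fst p) * below (snd q) (snd p) * \<mu> (fst p) (snd p) * \<phi> (fst q) (snd q))"
    by (rule sum.swap)
  also have "\<dots> = (\<Sum>u\<in>A. \<Sum>v\<in>A. \<phi> u v * adjoint A \<mu> u v)"
    unfolding adjoint_def by (simp add: sum.cartesian_product' sum_distrib_left mult_ac)
  finally show ?thesis .
qed

lemma Cauchy_Schwarz: "(\<Sum>x\<in>A. \<Sum>y\<in>A. \<phi> x y * \<psi> x y)\<^sup>2 \<le> sq_norm A \<phi> * sq_norm A \<psi>"
  using Cauchy_Schwarz_ineq_sum[of "\<lambda>p. \<phi> (fst p) (snd p)" "\<lambda>p. \<psi> (fst p) (snd p)" "A \<times> A"]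
  by (simp add: sq_norm_def sum.cartesian_product')

lemma hardy_mono: "(\<And>u v. f u v \<le> g u v) \<Longrightarrow> hardy A f x y \<le> hardy A g x y"
  and adjoint_mono: "(\<And>a b. \<mu> a b \<le> \<eta> a b) \<Longrightarrow> adjoint A \<mu> x y \<le> adjoint A \<eta> x y"
  for \<mu> \<eta> f g :: "vertex \<Rightarrow> vertex \<Rightarrow> real"
  by (auto simp: hardy_def adjoint_def intro!: sum_mono mult_left_mono)

context charge begin

lemma energy_le_mass: "sq_norm A f \<le> mass A \<mu>"
proof -
  have "sq_norm A f = (\<Sum>a\<in>A. \<Sum>b\<in>A. \<mu> a b * hardy A f a b)"
    unfolding duality sq_norm_def power2_eq_square ..
  also have "\<dots> \<le> mass A \<mu>"
    unfolding mass_def by (intro sum_mono compl)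
  finally show ?thesis .
qed

lemma restrict: "charge A (\<lambda>a b. if P a b then \<mu> a b else 0)" (is "charge A ?h")
proof
  show "0 \<le> ?h a b" for a b by (simp add: nonneg)
  have "adjoint A ?h x y \<le> f x y" for x y
    by (rule adjoint_mono) (simp add: nonneg)
  then have *: "hardy A (adjoint A ?h) a b \<le> hardy A f a b" for a b
    by (rule hardy_mono)
  show "?h a b * hardy A (adjoint A ?h) a b \<le> ?h a b" if "a \<in> A" "b \<in> A" for a b
    using mult_left_mono[OF * nonneg[of a b], of a b] compl[OF that] by auto
qed

end

text \<open>
  The substitute for the maximum principle (under which the left side would be at most the mass
  of \<open>\<eta>\<close>). Where the potential \<open>V\<close> of \<open>\<mu>\<close> is below \<open>T\<close> the bound is trivial. Where \<open>V > T\<close>, the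
  inequality \<open>V\<^sup>2 \<le> 2 V + 2 hardy A g\<close> makes \<open>V\<close> at most \<open>4 / T\<close> times \<open>hardy A g\<close>; duality and the
  Cauchy-Schwarz inequality bound the integral of \<open>hardy A g\<close> there by norms, and Chebyshev's
  inequality for the restricted charge \<open>h\<close> gains the remaining powers of \<open>T\<close>. The decay
  \<open>T\<close> to the power -3 beats the loss caused by taking \<open>T\<close> large in \<open>strong_capacitary\<close>.
\<close>

lemma mutual_energy:
  assumes "charge A \<mu>" "charge A \<eta>" "4 \<le> T"
  shows "(\<Sum>a\<in>A. \<Sum>b\<in>A. \<eta> a b * hardy A (adjoint A \<mu>) a b) \<le> T * mass A \<eta> + 64 / T ^ 3 * mass A \<mu>"
proof -
  interpret m: charge A \<mu> by fact
  interpret e: charge A \<eta> by fact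
  let ?V = "hardy A (adjoint A \<mu>)"
  \<comment> \<open>Restricting a charge keeps the complementarity condition, since its potential decreases.\<close>
  define h where "h = (\<lambda>a b. if T < ?V a b then \<eta> a b else 0)"
  interpret h: charge A h unfolding h_def by (rule e.restrict)
  define J where "J = (\<Sum>a\<in>A. \<Sum>b\<in>A. h a b * ?V a b)"
  define D where "D = (\<Sum>a\<in>A. \<Sum>b\<in>A. h a b * hardy A m.g a b)"
  have Vn: "0 \<le> ?V a b" for a b by (rule hardy_nonneg) simp
  have J0: "0 \<le> J" unfolding J_def by (intro sum_nonneg mult_nonneg_nonneg h.nonneg Vn)
  have m0: "0 \<le> mass A \<mu>" unfolding mass_def by (intro sum_nonneg m.nonneg)
  have h0: "0 \<le> mass A h" unfolding mass_def by (intro sum_nonneg h.nonneg)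
  have split: "(\<Sum>a\<in>A. \<Sum>b\<in>A. \<eta> a b * ?V a b) \<le> T * mass A \<eta> + J"
    unfolding mass_def J_def sum_distrib_left sum.distrib[symmetric]
    by (intro sum_mono) (use assms Vn e.nonneg in \<open>auto simp: h_def mult.commute[of T] intro: mult_left_mono\<close>)
  have TJ: "T * J \<le> 4 * D"
    unfolding J_def D_def sum_distrib_left
  proof (intro sum_mono)
    fix a b
    have "T * ?V a b \<le> 4 * hardy A m.g a b" if T: "T < ?V a b"
    proof -
      have "4 * ?V a b \<le> (?V a b)\<^sup>2" "T * ?V a b \<le> (?V a b)\<^sup>2"
        using T assms Vn[of a b] by (auto simp: power2_eq_square intro!: mult_right_mono)
      then show ?thesis using m.hardy_square_le[of a b] by linarith
    qed
    from mult_left_mono[OF this e.nonneg[of a b]]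
    show "T * (h a b * ?V a b) \<le> 4 * (h a b * hardy A m.g a b)"
      by (auto simp: h_def mult_ac)
  qed
  have Th: "T * mass A h \<le> J"
    unfolding mass_def J_def sum_distrib_left
    by (intro sum_mono) (use e.nonneg in \<open>auto simp: h_def mult.commute[of T] intro: mult_left_mono\<close>)
  have "D\<^sup>2 \<le> sq_norm A m.g * sq_norm A (adjoint A h)"
    unfolding D_def duality by (rule Cauchy_Schwarz)
  also have "\<dots> \<le> (4 * mass A \<mu>) * mass A h"
    using m.sq_norm_g m.energy_le_mass h.energy_le_mass m0
    by (intro mult_mono) (auto simp: sq_norm_def intro!: sum_nonneg)
  finally have D: "D\<^sup>2 \<le> 4 * mass A \<mu> * mass A h" .
  have "(T * J)\<^sup>2 \<le> (4 * D)\<^sup>2"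
    by (rule power_mono[OF TJ]) (use J0 assms in auto)
  then have "(T * J)\<^sup>2 \<le> 64 * mass A \<mu> * mass A h"
    using D by (simp add: power_mult_distrib)
  then have "T * (T * J)\<^sup>2 \<le> T * (64 * mass A \<mu> * mass A h)"
    using assms by (intro mult_left_mono) auto
  also have "\<dots> = 64 * mass A \<mu> * (T * mass A h)" by simp
  also have "\<dots> \<le> 64 * mass A \<mu> * J"
    using Th m0 by (intro mult_left_mono) auto
  finally have "(T ^ 3 * J) * J \<le> (64 * mass A \<mu>) * J"
    by (simp add: power2_eq_square power3_eq_cube mult_ac)
  then have "T ^ 3 * J \<le> 64 * mass A \<mu>"
    using J0 m0 by (cases "J = 0") auto
  then have "J \<le> 64 / T ^ 3 * mass A \<mu>"
    using assms by (simp add: field_simps)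
  with split show ?thesis by linarith
qed

text \<open>
  A geometric series indexed by any injective function of the summation variable, used for rows
  and for columns of a triangular array.
\<close>

lemma sum_half_powers:
  assumes "finite I" "inj_on d I"
  shows "(\<Sum>i\<in>I. (1/2::real) ^ d i) \<le> 2"
proof -
  have "(\<Sum>i\<in>I. (1/2::real) ^ d i) = (\<Sum>n\<in>d ` I. (1/2) ^ n)"
    using assms by (simp add: sum.reindex)
  also have "\<dots> \<le> (\<Sum>n. (1/2) ^ n)"
    using assms by (intro sum_le_suminf) auto
  also have "\<dots> = 2" by (simp add: suminf_geometric)
  finally show ?thesis .
qed

text \<open>
  The strong capacitary inequality, with \<open>mass A (\<mu> k)\<close> in the role of the capacity of the level
  set \<open>{hardy A \<phi> \<ge> c * 4 ^ k}\<close>. Integrating \<open>hardy A \<phi>\<close> against the charges bounds the left side \<open>S\<close> by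
  the pairing of \<open>\<phi>\<close> with \<open>F\<close>, the sum of the functions \<open>adjoint A (\<mu> k)\<close> weighted by the levels.
  So it suffices that the squared norm of \<open>F\<close> is at most \<open>20 * S\<close>. Its off-diagonal terms are mutual
  energies; for levels \<open>j \<le> k\<close> the threshold \<open>T = 4 * 2 ^ (k - j)\<close> makes both terms of
  \<open>mutual_energy\<close> decay like \<open>2\<close> to the power \<open>j - k\<close>: the first loses \<open>2 ^ (k - j)\<close> against the
  ratio \<open>4 ^ (k - j)\<close> of the levels, the second gains \<open>8 ^ (k - j)\<close> against it.
\<close>

lemma strong_capacitary:
  fixes \<phi> :: "vertex \<Rightarrow> vertex \<Rightarrow> real" and \<mu> :: "nat \<Rightarrow> vertex \<Rightarrow> vertex \<Rightarrow> real"
  assumes c: "0 < c" and ch: "\<And>k. charge A (\<mu> k)"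
    and supp: "\<And>k a b. a \<in> A \<Longrightarrow> b \<in> A \<Longrightarrow> \<mu> k a b \<noteq> 0 \<Longrightarrow> c * 4 ^ k \<le> hardy A \<phi> a b"
  shows "(\<Sum>k<n. (c * 4 ^ k)\<^sup>2 * mass A (\<mu> k)) \<le> 20 * sq_norm A \<phi>"
proof -
  define l where "l k = c * 4 ^ k" for k :: nat
  define m where "m k = mass A (\<mu> k)" for k
  define s where "s k = (l k)\<^sup>2 * m k" for k
  define e where "e j k = (\<Sum>a\<in>A. \<Sum>b\<in>A. \<mu> k a b * hardy A (adjoint A (\<mu> j)) a b)" for j k
  define F where "F x y = (\<Sum>k<n. l k * adjoint A (\<mu> k) x y)" for x y
  define S where "S = (\<Sum>k<n. s k)"
  have l0: "0 < l k" for k using c by (simp add: l_def)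
  have nn: "0 \<le> \<mu> k a b" for k a b using ch by (rule charge.nonneg)
  have m0: "0 \<le> m k" for k unfolding m_def mass_def by (intro sum_nonneg nn)
  have s0: "0 \<le> s k" for k unfolding s_def using m0 by simp
  have S0: "0 \<le> S" unfolding S_def by (intro sum_nonneg s0)
  have e_star: "e j k = (\<Sum>x\<in>A. \<Sum>y\<in>A. adjoint A (\<mu> j) x y * adjoint A (\<mu> k) x y)" for j k
    unfolding e_def duality ..
  have e_sym: "e j k = e k j" for j k unfolding e_star by (simp add: mult.commute)
  have e0: "0 \<le> e j k" for j k
    unfolding e_star by (intro sum_nonneg mult_nonneg_nonneg adjoint_nonneg nn)
  have pair: "l j * l k * e j k \<le> (1/2) ^ (k - j) * (4 * s k + s j)" if "j \<le> k" for j k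
  proof -
    obtain d where d: "k = j + d" using \<open>j \<le> k\<close> le_Suc_ex by blast
    have "e j k \<le> (4 * 2 ^ d) * m k + 64 / (4 * 2 ^ d) ^ 3 * m j"
      unfolding e_def m_def by (rule mutual_energy[OF ch ch]) simp
    from mult_left_mono[OF this, of "l j * l k"]
    have "l j * l k * e j k \<le> l j * l k * ((4 * 2 ^ d) * m k + 64 / (4 * 2 ^ d) ^ 3 * m j)"
      using l0[of j] l0[of k] by simp
    also have "\<dots> = (1/2) ^ d * (4 * s k + s j)"
    proof -
      have lk: "l k = l j * (2 ^ d)\<^sup>2"
        by (simp add: l_def d power_add power2_eq_square flip: power_mult_distrib)
      show ?thesis unfolding s_def lk
        by (simp add: field_simps power2_eq_square power3_eq_cube)
    qed
    finally show ?thesis by (simp add: d)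
  qed
  have filter: "(\<Sum>k\<in>{k. k < n \<and> P k}. h k) = (\<Sum>k<n. of_bool (P k) * h k)" for P and h :: "nat \<Rightarrow> real"
    by (rule sum.mono_neutral_cong_left) auto
  have "sq_norm A F = (\<Sum>x\<in>A. \<Sum>y\<in>A. \<Sum>j<n. \<Sum>k<n. l j * l k * (adjoint A (\<mu> j) x y * adjoint A (\<mu> k) x y))"
    unfolding sq_norm_def F_def power2_eq_square sum_product by (simp add: mult_ac)
  also have "\<dots> = (\<Sum>p\<in>A\<times>A. \<Sum>q\<in>{..<n}\<times>{..<n}. l (fst q) * l (snd q) * (adjoint A (\<mu> (fst q)) (fst p) (snd p) * adjoint A (\<mu> (snd q)) (fst p) (snd p)))"
    by (simp add: sum.cartesian_product')
  also have "\<dots> = (\<Sum>q\<in>{..<n}\<times>{..<n}. \<Sum>p\<in>A\<times>A. l (fst q) * l (snd q) * (adjoint A (\<mu> (fst q)) (fst p) (snd p) * adjoint A (\<mu> (snd q)) (fst p) (snd p)))"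
    by (rule sum.swap)
  also have "\<dots> = (\<Sum>j<n. \<Sum>k<n. l j * l k * e j k)"
    by (simp add: sum.cartesian_product' e_star sum_distrib_left)
  also have "\<dots> \<le> (\<Sum>j<n. \<Sum>k<n. of_bool (j \<le> k) * (l j * l k * e j k) + of_bool (k \<le> j) * (l j * l k * e j k))"
    by (intro sum_mono) (use l0 e0 in \<open>auto intro!: mult_nonneg_nonneg less_imp_le\<close>)
  also have "\<dots> = (\<Sum>j<n. \<Sum>k<n. of_bool (j \<le> k) * (l j * l k * e j k)) + (\<Sum>j<n. \<Sum>k<n. of_bool (k \<le> j) * (l j * l k * e j k))"
    by (simp add: sum.distrib)
  also have "(\<Sum>j<n. \<Sum>k<n. of_bool (k \<le> j) * (l j * l k * e j k)) = (\<Sum>j<n. \<Sum>k<n. of_bool (j \<le> k) * (l j * l k * e j k))"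
    by (subst sum.swap) (simp add: e_sym mult_ac)
  also have "(\<Sum>j<n. \<Sum>k<n. of_bool (j \<le> k) * (l j * l k * e j k)) \<le> (\<Sum>j<n. \<Sum>k<n. of_bool (j \<le> k) * ((1/2) ^ (k - j) * (4 * s k + s j)))"
    by (intro sum_mono) (use pair in auto)
  also have "\<dots> = (\<Sum>j<n. \<Sum>k<n. of_bool (j \<le> k) * (1/2) ^ (k - j) * (4 * s k)) + (\<Sum>j<n. \<Sum>k<n. of_bool (j \<le> k) * (1/2) ^ (k - j) * s j)"
    by (simp add: distrib_left sum.distrib mult_ac)
  also have "(\<Sum>j<n. \<Sum>k<n. of_bool (j \<le> k) * (1/2) ^ (k - j) * (4 * s k)) = (\<Sum>k<n. 4 * s k * (\<Sum>j\<in>{j. j < n \<and> j \<le> k}. (1/2) ^ (k - j)))"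
    unfolding filter
    by (subst sum.swap) (simp add: sum_distrib_left mult_ac del: sum_mult_of_bool_eq sum_of_bool_mult_eq)
  also have "\<dots> \<le> (\<Sum>k<n. 4 * s k * 2)"
    by (intro sum_mono mult_left_mono sum_half_powers) (auto simp: s0 inj_on_def)
  also have "(\<Sum>j<n. \<Sum>k<n. of_bool (j \<le> k) * (1/2) ^ (k - j) * s j) = (\<Sum>j<n. s j * (\<Sum>k\<in>{k. k < n \<and> j \<le> k}. (1/2) ^ (k - j)))"
    unfolding filter by (simp add: sum_distrib_left mult_ac del: sum_mult_of_bool_eq sum_of_bool_mult_eq)
  also have "\<dots> \<le> (\<Sum>j<n. s j * 2)"
    by (intro sum_mono mult_left_mono sum_half_powers) (auto simp: s0 inj_on_def)
  finally have F: "sq_norm A F \<le> 20 * S"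
    by (simp add: S_def flip: sum_distrib_left sum_distrib_right)
  have "S \<le> (\<Sum>k<n. l k * (\<Sum>a\<in>A. \<Sum>b\<in>A. \<mu> k a b * hardy A \<phi> a b))"
    unfolding S_def
  proof (intro sum_mono)
    fix k
    have "l k * m k \<le> (\<Sum>a\<in>A. \<Sum>b\<in>A. \<mu> k a b * hardy A \<phi> a b)"
      unfolding m_def mass_def sum_distrib_left
    proof (intro sum_mono)
      fix a b assume "a \<in> A" "b \<in> A"
      then show "l k * \<mu> k a b \<le> \<mu> k a b * hardy A \<phi> a b"
        using supp[of a b k] mult_left_mono[OF _ nn[of k a b], of "l k" "hardy A \<phi> a b"]
        by (cases "\<mu> k a b = 0") (auto simp: l_def mult.commute)
    qed
    from mult_left_mono[OF this less_imp_le[OF l0[of k]]]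
    show "s k \<le> l k * (\<Sum>a\<in>A. \<Sum>b\<in>A. \<mu> k a b * hardy A \<phi> a b)"
      by (simp add: s_def power2_eq_square mult_ac)
  qed
  also have "\<dots> = (\<Sum>x\<in>A. \<Sum>y\<in>A. \<phi> x y * F x y)"
    unfolding duality F_def sum_distrib_left
    by (subst sum.swap, rule sum.cong[OF refl], subst sum.swap) (simp add: mult_ac)
  finally have "S\<^sup>2 \<le> (\<Sum>x\<in>A. \<Sum>y\<in>A. \<phi> x y * F x y)\<^sup>2"
    using S0 by (rule power_mono)
  also have "\<dots> \<le> sq_norm A \<phi> * sq_norm A F" by (rule Cauchy_Schwarz)
  also have "\<dots> \<le> sq_norm A \<phi> * (20 * S)"
    by (intro mult_left_mono F) (auto simp: sq_norm_def intro!: sum_nonneg)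
  finally have "S * S \<le> (20 * sq_norm A \<phi>) * S"
    by (simp add: power2_eq_square mult_ac)
  then have "S \<le> 20 * sq_norm A \<phi>"
    using S0 by (cases "S = 0") (auto simp: sq_norm_def intro!: sum_nonneg mult_nonneg_nonneg)
  then show ?thesis by (simp add: S_def s_def l_def m_def)
qed

section \<open>Equilibrium charges\<close>

lemma compact_box: "compact {m :: 'i \<Rightarrow> real. \<forall>p. m p \<in> (if p \<in> E then {0..1} else {0})}"
proof -
  have "compactin (product_topology (\<lambda>_::'i. euclidean) UNIV) (\<Pi>\<^sub>E p\<in>UNIV. if p \<in> E then {0..1::real} else {0})"
    by (simp add: compactin_PiE)
  moreover have "(\<Pi>\<^sub>E p\<in>UNIV. if p \<in> E then {0..1::real} else {0}) = {m. \<forall>p. m p \<in> (if p \<in> E then {0..1} else {0})}"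
    by (auto simp: PiE_def Pi_def)
  ultimately show ?thesis by (simp add: euclidean_product_topology)
qed

text \<open>
  A linear complementarity problem, solved by minimising the quadratic form minus twice the mass
  (here halved) over the compact box of functions with values in \<open>[0, 1]\<close>. The upper bound 1
  of the box is never active where the potential is below 1: the diagonal entry alone shows that
  the value is then below 1. So the value may be increased there, and decreased wherever it is
  positive; minimality says that neither lowers the functional to first order.
\<close>

lemma complementarity:
  fixes K :: "'i \<Rightarrow> 'i \<Rightarrow> real"
  assumes E: "finite E" and sym: "\<And>p q. K p q = K q p" and nn: "\<And>p q. 0 \<le> K p q"
    and diag: "\<And>p. p \<in> E \<Longrightarrow> 1 \<le> K p p"
  obtains m where "\<And>p. 0 \<le> m p" "\<And>p. p \<notin> E \<Longrightarrow> m p = 0"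
    "\<And>p. p \<in> E \<Longrightarrow> 1 \<le> (\<Sum>q\<in>E. K p q * m q)"
    "\<And>p. p \<in> E \<Longrightarrow> m p * (\<Sum>q\<in>E. K p q * m q) \<le> m p"
proof -
  let ?B = "{m :: 'i \<Rightarrow> real. \<forall>p. m p \<in> (if p \<in> E then {0..1} else {0})}"
  define V where "V m p = (\<Sum>q\<in>E. K p q * m q)" for m p
  define J where "J m = (\<Sum>p\<in>E. m p * V m p) / 2 - (\<Sum>p\<in>E. m p)" for m
  have cont: "continuous_on ?B J"
    unfolding J_def V_def
    by (intro continuous_intros continuous_on_subset[OF continuous_on_product_coordinates]) auto
  have ne: "?B \<noteq> {}" by (auto intro!: exI[of _ "\<lambda>_. 0"])
  obtain m where m: "m \<in> ?B" and min: "\<And>m'. m' \<in> ?B \<Longrightarrow> J m \<le> J m'"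
    using continuous_attains_inf[OF compact_box ne cont] by auto
  have m01: "0 \<le> m p" "m p \<le> 1" and mE: "p \<notin> E \<Longrightarrow> m p = 0" for p
    using m by (auto split: if_splits dest: spec[of _ p])
  have step: "0 \<le> t * (V m p - 1) + t\<^sup>2 * K p p / 2" if p: "p \<in> E" and t: "0 \<le> m p + t" "m p + t \<le> 1" for p t
  proof -
    let ?d = "\<lambda>q. of_bool (q = p) :: real"
    let ?m = "\<lambda>q. m q + t * ?d q"
    have d: "(\<Sum>q\<in>E. h q * ?d q) = h p" for h
      using E p by (simp add: of_bool_def if_distrib sum.delta' cong: if_cong)
    have V: "V ?m r = V m r + t * K r p" for r
    proof -
      have "V ?m r = V m r + t * (\<Sum>q\<in>E. K r q * ?d q)"
        unfolding V_def by (simp only: distrib_left sum.distrib sum_distrib_left mult.left_commute)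
      then show ?thesis using d[of "K r"] by simp
    qed
    have "(\<Sum>r\<in>E. ?m r * V ?m r) = (\<Sum>r\<in>E. m r * V m r) + t * (\<Sum>r\<in>E. K p r * m r)
        + t * (\<Sum>r\<in>E. (V m r + t * K r p) * ?d r)"
      unfolding V by (simp add: algebra_simps sum.distrib sum_distrib_left sym[of _ p])
    also have "\<dots> = (\<Sum>r\<in>E. m r * V m r) + 2 * t * V m p + t\<^sup>2 * K p p"
      unfolding d by (simp add: V_def algebra_simps power2_eq_square)
    finally have "J ?m = J m + (t * (V m p - 1) + t\<^sup>2 * K p p / 2)"
      using d[of "\<lambda>_. t"] by (simp add: J_def sum.distrib field_simps)
    moreover have "?m \<in> ?B" using m01 mE p t by (auto simp: of_bool_def)
    ultimately show ?thesis using min[of ?m] by simp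
  qed
  have low: "1 \<le> V m p" if p: "p \<in> E" for p
  proof (rule ccontr)
    assume "\<not> 1 \<le> V m p"
    then have g: "V m p < 1" by simp
    have k: "1 \<le> K p p" using diag p .
    have "K p p * m p \<le> V m p"
      unfolding V_def using member_le_sum[OF p _ E, of "\<lambda>q. K p q * m q"] nn m01 by auto
    moreover have "1 * m p \<le> K p p * m p" using k m01 by (intro mult_right_mono) auto
    ultimately have mp: "m p < 1" using g by simp
    \<comment> \<open>Small enough to stay in the box and for the linear term to beat the quadratic one.\<close>
    define t where "t = min (1 - m p) ((1 - V m p) / K p p)"
    have t: "0 < t" "t \<le> 1 - m p" "t * K p p \<le> 1 - V m p"
      using mp g k by (auto simp: t_def min_def field_simps)
    have "0 \<le> t * (V m p - 1) + t\<^sup>2 * K p p / 2"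
      using t m01[of p] by (intro step p) auto
    also have "\<dots> = t * ((V m p - 1) + t * K p p / 2)"
      by (simp add: algebra_simps power2_eq_square)
    also have "\<dots> < 0" using t g by (intro mult_pos_neg) auto
    finally show False by simp
  qed
  have high: "m p * V m p \<le> m p" if p: "p \<in> E" for p
  proof (rule ccontr)
    assume "\<not> m p * V m p \<le> m p"
    then have "0 < m p * (V m p - 1)" by (simp add: algebra_simps)
    then have g: "0 < m p" "1 < V m p"
      using m01[of p] by (auto simp: zero_less_mult_iff)
    have k: "1 \<le> K p p" using diag p .
    define t where "t = min (m p) ((V m p - 1) / K p p)"
    have t: "0 < t" "t \<le> m p" "t * K p p \<le> V m p - 1"
      using g k by (auto simp: t_def min_def field_simps)
    have "0 \<le> (-t) * (V m p - 1) + (-t)\<^sup>2 * K p p / 2"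
      using t m01[of p] by (intro step p) auto
    also have "\<dots> = t * (t * K p p / 2 - (V m p - 1))"
      by (simp add: algebra_simps power2_eq_square)
    also have "\<dots> < 0" using t g by (intro mult_pos_neg) auto
    finally show False by simp
  qed
  show thesis
    using that[of m] m01 mE low high unfolding V_def by blast
qed

text \<open>
  An equilibrium charge for \<open>E\<close>: carried by \<open>E\<close>, with potential at least 1 on \<open>E\<close> and at most
  1 on its own support. The kernel \<open>K\<close> is the energy form of point charges.
\<close>

lemma equilibrium:
  assumes A: "finite A" and E: "E \<subseteq> A \<times> A"
  obtains \<mu> where "charge A \<mu>" "\<And>a b. \<mu> a b \<noteq> 0 \<Longrightarrow> (a, b) \<in> E"
    "\<And>a b. (a, b) \<in> E \<Longrightarrow> 1 \<le> hardy A (adjoint A \<mu>) a b"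
proof -
  define K where "K p q = (\<Sum>u\<in>A. \<Sum>v\<in>A. below u (fst p) * below v (snd p) * (below u (fst q) * below v (snd q)))" for p q
  have finE: "finite E" using A E finite_subset by blast
  have diag: "1 \<le> K p p" if "p \<in> E" for p
  proof -
    have p: "fst p \<in> A" "snd p \<in> A" using that E by auto
    let ?h = "\<lambda>u v. below u (fst p) * below v (snd p) * (below u (fst p) * below v (snd p))"
    have "1 = ?h (fst p) (snd p)" by simp
    also have "\<dots> \<le> (\<Sum>v\<in>A. ?h (fst p) v)"
      by (rule member_le_sum[OF p(2) _ A]) auto
    also have "\<dots> \<le> K p p"
      unfolding K_def by (rule member_le_sum[OF p(1) _ A, of "\<lambda>u. \<Sum>v\<in>A. ?h u v"]) (auto intro!: sum_nonneg)
    finally show ?thesis .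
  qed
  obtain m where m: "\<And>p. 0 \<le> m p" "\<And>p. p \<notin> E \<Longrightarrow> m p = 0"
    "\<And>p. p \<in> E \<Longrightarrow> 1 \<le> (\<Sum>q\<in>E. K p q * m q)"
    "\<And>p. p \<in> E \<Longrightarrow> m p * (\<Sum>q\<in>E. K p q * m q) \<le> m p"
  proof (rule complementarity[OF finE _ _ diag])
    show "K p q = K q p" "0 \<le> K p q" for p q
      by (auto simp: K_def mult_ac intro!: sum_nonneg)
  qed blast+
  define \<mu> where "\<mu> a b = m (a, b)" for a b
  have V: "hardy A (adjoint A \<mu>) a b = (\<Sum>q\<in>E. K (a, b) q * m q)" for a b
  proof -
    have "(\<Sum>q\<in>E. K (a, b) q * m q) = (\<Sum>q\<in>A\<times>A. K (a, b) q * m q)"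
      using A E m(2) by (intro sum.mono_neutral_left) auto
    also have "\<dots> = (\<Sum>q\<in>A\<times>A. \<Sum>p\<in>A\<times>A. below (fst p) a * below (snd p) b * (below (fst p) (fst q) * below (snd p) (snd q) * m q))"
      unfolding K_def sum_distrib_right by (simp add: sum.cartesian_product' mult_ac)
    also have "\<dots> = (\<Sum>p\<in>A\<times>A. \<Sum>q\<in>A\<times>A. below (fst p) a * below (snd p) b * (below (fst p) (fst q) * below (snd p) (snd q) * m q))"
      by (rule sum.swap)
    also have "\<dots> = hardy A (adjoint A \<mu>) a b"
      by (simp add: hardy_def adjoint_def \<mu>_def sum.cartesian_product' sum_distrib_left mult_ac)
    finally show ?thesis ..
  qed
  show thesis
  proof (rule that[of \<mu>])
    show "charge A \<mu>"
    proof
      show "0 \<le> \<mu> a b" for a b by (simp add: \<mu>_def m)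
      show "\<mu> a b * hardy A (adjoint A \<mu>) a b \<le> \<mu> a b" for a b
        using m(2)[of "(a, b)"] m(4)[of "(a, b)"] unfolding V \<mu>_def
        by (cases "(a, b) \<in> E") simp_all
    qed
    show "(a, b) \<in> E" if "\<mu> a b \<noteq> 0" for a b
      using m(2)[of "(a, b)"] that unfolding \<mu>_def by blast
    show "1 \<le> hardy A (adjoint A \<mu>) a b" if "(a, b) \<in> E" for a b
      unfolding V by (rule m(3)[OF that])
  qed
qed

section \<open>From the compactified bitree to finite bitrees\<close>

text \<open>
  If \<open>v\<close> is an ancestor of \<open>x\<close> but not of \<open>y\<close>, then \<open>x\<close> and \<open>y\<close> have at most \<open>length v\<close> common
  ancestors, whereas \<open>x\<close> has at least one more; this keeps their distance away from 0.
\<close>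

lemma open_below: "open {x. x \<le> Vert v}"
  unfolding open_dist
proof (intro ballI exI conjI allI impI)
  fix x y
  assume x: "x \<in> {x. x \<le> Vert v}" and d: "dist y x < 1 / 2 ^ (length v + 2)"
  show "y \<in> {x. x \<le> Vert v}"
  proof (rule ccontr)
    assume "y \<notin> {x. x \<le> Vert v}"
    then have vx: "v \<in> ancestors x" and vy: "v \<notin> ancestors y"
      using x by (auto simp: ancestors_def)
    have "ancestors y \<inter> ancestors x \<subseteq> set (prefixes v) - {v}"
    proof
      fix u assume u: "u \<in> ancestors y \<inter> ancestors x"
      then have "\<not> prefix v u" using vy ancestors_prefix_closed by blast
      then show "u \<in> set (prefixes v) - {v}"
        using ancestors_chain[of u x v] u vx by auto
    qed
    from dmeet_def[of y x] card_mono[OF _ this] finite_subset[OF this]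
    have "dmeet y x \<le> enat (length v)" by simp
    then have 1: "1 / 2 ^ length v \<le> two_pow_neg (dmeet y x)"
      using two_pow_neg_antimono by (fastforce simp: two_pow_neg_def)
    have "dmeet (Vert v) (Vert v) \<le> dmeet x x"
      using ancestors_prefix_closed[OF vx] by (intro dmeet_mono) (auto simp: ancestors_Vert)
    moreover have "dmeet (Vert v) (Vert v) = enat (Suc (length v))"
      by (simp add: dmeet_def ancestors_Vert flip: set_prefixes_eq)
    ultimately have 2: "two_pow_neg (dmeet x x) \<le> 1 / 2 ^ Suc (length v)"
      using two_pow_neg_antimono by (fastforce simp: two_pow_neg_def)
    have 3: "two_pow_neg (dmeet y y) \<le> two_pow_neg (dmeet y x)"
      by (intro two_pow_neg_antimono dmeet_mono) auto
    show False
    proof -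
      define P where "P = 1 / (2::real) ^ length v"
      have P: "1 / (2::real) ^ (length v + 2) = P / 4" "1 / (2::real) ^ Suc (length v) = P / 2"
        by (simp_all add: P_def)
      have "False" if "P \<le> t" "tx \<le> P / 2" "ty \<le> t" "t - 1/2 * (ty + tx) < P / 4" for t tx ty
        using that by (simp add: field_simps)
      from this[OF 1[folded P_def] 2[unfolded P] 3 d[unfolded dist_tbar_def delta0_def P]]
      show ?thesis .
    qed
  qed
qed simp

lemma Sset_Times: "Sset (a, b) = {x. x \<le> Vert a} \<times> {y. y \<le> Vert b}"
  by (auto simp: Sset_def emb2_def)

lemma Sset_borel [measurable]: "Sset \<alpha> \<in> sets borel"
  by (cases \<alpha>) (auto simp: Sset_Times intro!: borel_open open_Times open_below)

definition tree_upto :: "nat \<Rightarrow> vertex set" where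
  "tree_upto N = {v. length v \<le> N}"

lemma finite_tree_upto [simp]: "finite (tree_upto N)"
  using finite_lists_length_le[of "UNIV :: bool set" N] by (simp add: tree_upto_def)

text \<open>
  The deepest ancestor of a point up to level \<open>N\<close>. A function carried by the first \<open>N\<close> levels has
  the same potential at a point and at its truncation.
\<close>

fun trunc :: "nat \<Rightarrow> tbar \<Rightarrow> vertex" where
  "trunc N (Vert a) = take N a"
| "trunc N (Bdry w) = desc w N"

lemma trunc_tree_upto: "trunc N x \<in> tree_upto N"
  by (cases x) (auto simp: tree_upto_def)

lemma le_trunc: "x \<le> Vert (trunc N x)"
  by (cases x) (auto simp: take_is_prefix)

lemma le_Vert_iff_trunc:
  assumes "v \<in> tree_upto N"
  shows "x \<le> Vert v \<longleftrightarrow> prefix v (trunc N x)"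
proof
  assume "prefix v (trunc N x)"
  then show "x \<le> Vert v"
    using le_trunc[of x N] order_trans[of x "Vert (trunc N x)" "Vert v"] by simp
next
  assume "x \<le> Vert v"
  with assms show "prefix v (trunc N x)"
  proof (cases x)
    case (Vert a)
    then have "prefix v a" using \<open>x \<le> Vert v\<close> by simp
    then have "v = take (length v) (take N a)"
      using assms by (auto simp: tree_upto_def prefix_def)
    then show ?thesis using Vert take_is_prefix[of "length v" "take N a"] by simp
  qed (auto simp: tree_upto_def prefix_desc_iff)
qed

lemma infsum_eq_SUP:
  fixes f :: "'a \<Rightarrow> ennreal"
  assumes "incseq X" "\<And>n. finite (X n)" "(\<Union>n. X n) = UNIV"
  shows "(\<Sum>\<^sub>\<infinity>x. f x) = (SUP n. sum f (X n))"
proof (rule antisym)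
  show "(\<Sum>\<^sub>\<infinity>x. f x) \<le> (SUP n. sum f (X n))"
  proof (subst nonneg_infsum_complete, simp, rule SUP_least)
    fix F :: "'a set" assume "F \<in> {F. finite F \<and> F \<subseteq> UNIV}"
    then have "finite F" by simp
    then have "\<exists>n. F \<subseteq> X n"
    proof (induction F rule: finite_induct)
      case (insert x F)
      then obtain n where n: "F \<subseteq> X n" by blast
      have "x \<in> (\<Union>n. X n)" using assms(3) by simp
      then obtain k where k: "x \<in> X k" by blast
      have "X n \<subseteq> X (max n k)" "X k \<subseteq> X (max n k)"
        by (rule incseqD[OF assms(1)], simp)+
      with n k show ?case by blast
    qed simp
    then obtain n where "F \<subseteq> X n" ..
    then have "sum f F \<le> sum f (X n)"
      using assms by (intro sum_mono2) auto
    then show "sum f F \<le> (SUP n. sum f (X n))"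
      by (rule SUP_upper2[OF UNIV_I])
  qed
  show "(SUP n. sum f (X n)) \<le> (\<Sum>\<^sub>\<infinity>x. f x)"
    using assms by (subst nonneg_infsum_complete) (auto intro!: SUP_mono)
qed

lemma infsum_pairs: "(\<Sum>\<^sub>\<infinity>\<alpha>. f \<alpha>) = (SUP N. sum f (tree_upto N \<times> tree_upto N))" for f :: "vertex \<times> vertex \<Rightarrow> ennreal"
proof (rule infsum_eq_SUP)
  show "incseq (\<lambda>N. tree_upto N \<times> tree_upto N)" by (force simp: incseq_def tree_upto_def)
  have "p \<in> (\<Union>n. tree_upto n \<times> tree_upto n)" for p :: "vertex \<times> vertex"
    by (rule UN_I[of "max (length (fst p)) (length (snd p))"]) (simp_all add: tree_upto_def mem_Times_iff)
  from this show "(\<Union>n. tree_upto n \<times> tree_upto n) = UNIV"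
    by (rule UNIV_eq_I[symmetric])
qed simp

lemma l2_norm_sq_eq: "l2_norm_sq \<phi> = (SUP N. ennreal (sq_norm (tree_upto N) (curry \<phi>)))"
  unfolding l2_norm_sq_def infsum_pairs
  by (simp add: sq_norm_def sum.cartesian_product' sum_nonneg)

lemma Iop_eq:
  assumes "\<And>\<alpha>. 0 \<le> \<phi> \<alpha>"
  shows "Iop \<phi> (x, y) = (SUP N. ennreal (hardy (tree_upto N) (curry \<phi>) (trunc N x) (trunc N y)))"
proof -
  have "Iop \<phi> (x, y) = (\<Sum>\<^sub>\<infinity>\<alpha>. if (x, y) \<le> emb2 \<alpha> then ennreal (\<phi> \<alpha>) else 0)"
    unfolding Iop_def by (rule infsum_cong_neutral) auto
  also have "\<dots> = (SUP N. ennreal (hardy (tree_upto N) (curry \<phi>) (trunc N x) (trunc N y)))"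
    unfolding infsum_pairs
  proof (intro SUP_cong refl)
    fix N
    have *: "(if (x, y) \<le> emb2 \<alpha> then ennreal (\<phi> \<alpha>) else 0)
        = ennreal (below (fst \<alpha>) (trunc N x) * below (snd \<alpha>) (trunc N y) * \<phi> \<alpha>)"
      if "\<alpha> \<in> tree_upto N \<times> tree_upto N" for \<alpha>
      using that by (cases \<alpha>) (auto simp: emb2_def le_Vert_iff_trunc below_def)
    have "(\<Sum>\<alpha>\<in>tree_upto N \<times> tree_upto N. if (x, y) \<le> emb2 \<alpha> then ennreal (\<phi> \<alpha>) else 0)
        = (\<Sum>\<alpha>\<in>tree_upto N \<times> tree_upto N. ennreal (below (fst \<alpha>) (trunc N x) * below (snd \<alpha>) (trunc N y) * \<phi> \<alpha>))"
      by (rule sum.cong[OF refl *])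
    also have "\<dots> = ennreal (\<Sum>\<alpha>\<in>tree_upto N \<times> tree_upto N. below (fst \<alpha>) (trunc N x) * below (snd \<alpha>) (trunc N y) * \<phi> \<alpha>)"
      using assms by (intro sum_ennreal) simp
    finally show "(\<Sum>\<alpha>\<in>tree_upto N \<times> tree_upto N. if (x, y) \<le> emb2 \<alpha> then ennreal (\<phi> \<alpha>) else 0)
        = ennreal (hardy (tree_upto N) (curry \<phi>) (trunc N x) (trunc N y))"
      by (simp add: hardy_def sum.cartesian_product')
  qed
  finally show ?thesis .
qed

lemma hardy_prefix:
  assumes "\<And>a b. 0 \<le> f a b" "prefix x a" "prefix y b"
  shows "hardy A f x y \<le> hardy A f a b"
  using hardy_antimono[of f x a y b A] assms by (simp add: below_def)

text \<open>
  The function \<open>adjoint (tree_upto N) \<mu>\<close> is admissible, and its squared norm is the energy of \<open>\<mu>\<close>.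
\<close>

lemma Cap_le_mass:
  assumes E: "E \<subseteq> tree_upto N \<times> tree_upto N" and ch: "charge (tree_upto N) \<mu>"
    and V: "\<And>a b. (a, b) \<in> E \<Longrightarrow> 1 \<le> hardy (tree_upto N) (adjoint (tree_upto N) \<mu>) a b"
  shows "Cap (\<Union>\<alpha>\<in>E. bdSset \<alpha>) \<le> ennreal (mass (tree_upto N) \<mu>)"
proof -
  interpret charge "tree_upto N" \<mu> by fact
  define \<psi> where "\<psi> \<alpha> = (if \<alpha> \<in> tree_upto N \<times> tree_upto N then f (fst \<alpha>) (snd \<alpha>) else 0)" for \<alpha>
  have nn: "0 \<le> \<psi> \<alpha>" for \<alpha> by (simp add: \<psi>_def)
  have "1 \<le> Iop \<psi> \<zeta>" if E\<zeta>: "\<zeta> \<in> (\<Union>\<alpha>\<in>E. bdSset \<alpha>)" for \<zeta>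
  proof -
    obtain x y where \<zeta>: "\<zeta> = (x, y)" by (cases \<zeta>)
    obtain \<alpha> where \<alpha>: "\<alpha> \<in> E" "(x, y) \<in> Sset \<alpha>"
      using E\<zeta> unfolding \<zeta> bdSset_def by blast
    obtain a b where "\<alpha> = (a, b)" by (cases \<alpha>)
    with \<alpha> have ab: "(a, b) \<in> E" and "(x, y) \<in> Sset (a, b)" by simp_all
    then have "prefix a (trunc N x)" "prefix b (trunc N y)"
      using E by (auto simp: Sset_Times le_Vert_iff_trunc)
    then have "hardy (tree_upto N) f a b \<le> hardy (tree_upto N) f (trunc N x) (trunc N y)"
      by (intro hardy_prefix) auto
    also have "\<dots> = hardy (tree_upto N) (curry \<psi>) (trunc N x) (trunc N y)"
      unfolding hardy_def by (intro sum.cong refl) (simp add: \<psi>_def)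
    finally have "1 \<le> ennreal (hardy (tree_upto N) (curry \<psi>) (trunc N x) (trunc N y))"
      using V[OF ab] by simp
    also have "\<dots> \<le> Iop \<psi> \<zeta>"
      unfolding \<zeta> Iop_eq[of \<psi>, OF nn] by (rule SUP_upper) simp
    finally show ?thesis .
  qed
  then have "Cap (\<Union>\<alpha>\<in>E. bdSset \<alpha>) \<le> l2_norm_sq \<psi>"
    unfolding Cap_def using nn by (intro INF_lower) auto
  also have "\<dots> = (\<Sum>\<^sub>\<infinity>\<alpha>\<in>tree_upto N \<times> tree_upto N. ennreal ((\<psi> \<alpha>)\<^sup>2))"
    unfolding l2_norm_sq_def by (rule infsum_cong_neutral) (auto simp: \<psi>_def)
  also have "\<dots> = (\<Sum>\<alpha>\<in>tree_upto N \<times> tree_upto N. ennreal ((f (fst \<alpha>) (snd \<alpha>))\<^sup>2))"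
    by (simp add: \<psi>_def cong: sum.cong)
  also have "\<dots> = ennreal (sq_norm (tree_upto N) f)"
    by (simp add: sq_norm_def sum.cartesian_product' sum_nonneg)
  also have "\<dots> \<le> ennreal (mass (tree_upto N) \<mu>)"
    by (intro ennreal_leI energy_le_mass)
  finally show ?thesis .
qed

text \<open>
  Clearing a denominator that might be 0 or infinite: a finite quotient excludes the first unless
  the numerator vanishes, and the real bound \<open>m\<close> excludes the second.
\<close>

lemma le_times_of_divide_le:
  fixes x C Q :: ennreal
  assumes "x / C \<le> Q" "C \<le> ennreal m" "Q < top"
  shows "x \<le> Q * ennreal m"
proof (cases "C = 0")
  case True
  with assms show ?thesis
    by (cases "x = 0") (auto simp: ennreal_divide_zero top_unique)
next
  case False
  have "C < top" using assms(2) by (rule le_less_trans) simp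
  with False have "x = (x / C) * C"
    by (simp add: ennreal_divide_times)
  also have "\<dots> \<le> Q * ennreal m"
    using assms by (intro mult_mono) auto
  finally show ?thesis .
qed

lemma quotient_le_cap_sup:
  assumes "finite E" "E \<noteq> {}"
  shows "emeasure \<nu> (\<Union>\<alpha>\<in>E. Sset \<alpha>) / Cap (\<Union>\<alpha>\<in>E. bdSset \<alpha>) \<le> cap_sup \<nu>"
proof -
  obtain e where "bij_betw e {1..card E} E"
    using ex_bij_betw_nat_finite_1[OF assms(1)] by blast
  then have e: "e ` {1..card E} = E" by (simp add: bij_betw_def)
  have "1 \<le> card E" using assms by (simp add: Suc_le_eq card_gt_0_iff)
  have U: "(\<Union>j\<in>{1..card E}. g (e j)) = (\<Union>\<alpha>\<in>E. g \<alpha>)" for g :: "_ \<Rightarrow> (tbar \<times> tbar) set"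
  proof -
    have "(\<Union>j\<in>{1..card E}. g (e j)) = (\<Union>\<alpha>\<in>e ` {1..card E}. g \<alpha>)" by simp
    then show ?thesis unfolding e .
  qed
  show ?thesis
    unfolding cap_sup_def U[of Sset, symmetric] U[of bdSset, symmetric]
    by (rule SUP_upper2[of "(card E, e)"]) (use \<open>1 \<le> card E\<close> in simp_all)
qed

section \<open>The embedding under the capacitary condition\<close>

text \<open>
  A value \<open>t \<ge> c\<close> lies in one of the intervals from \<open>c * 4 ^ k\<close> to \<open>c * 4 ^ Suc k\<close>, and the
  factor 16 is the square of the ratio of the endpoints.
\<close>

lemma layer_cake:
  fixes t c :: real
  assumes "0 < c" "t = 0 \<or> c \<le> t" "t < c * 4 ^ n"
  shows "t\<^sup>2 \<le> (\<Sum>k<n. 16 * (c * 4 ^ k)\<^sup>2 * of_bool (c * 4 ^ k \<le> t))"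
proof (cases "t = 0")
  case False
  with assms have t: "c \<le> t" by simp
  define j where "j = (LEAST j. t < c * 4 ^ j)"
  have j: "t < c * 4 ^ j" "j \<le> n"
    unfolding j_def using assms(3) by (rule LeastI, rule Least_le)
  have "j \<noteq> 0" using j(1) t by (intro notI) simp
  then obtain k where jk: "j = Suc k" using not0_implies_Suc by blast
  have "\<not> t < c * 4 ^ k"
    by (rule not_less_Least) (simp add: jk flip: j_def)
  with j jk have k: "k < n" "c * 4 ^ k \<le> t" "t < c * 4 ^ Suc k" by auto
  have "t\<^sup>2 \<le> (c * 4 ^ Suc k)\<^sup>2"
    using k t assms(1) by (intro power_mono) auto
  also have "\<dots> = 16 * (c * 4 ^ k)\<^sup>2 * of_bool (c * 4 ^ k \<le> t)"
    using k by (simp add: power_mult_distrib)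
  also have "\<dots> \<le> (\<Sum>k<n. 16 * (c * 4 ^ k)\<^sup>2 * of_bool (c * 4 ^ k \<le> t))"
    using k by (intro member_le_sum) auto
  finally show ?thesis .
qed (auto intro!: sum_nonneg)

lemma truncated_potential_measurable [measurable]:
  "(\<lambda>\<zeta>. hardy (tree_upto N) \<phi> (trunc N (fst \<zeta>)) (trunc N (snd \<zeta>))) \<in> borel_measurable borel"
proof -
  have *: "hardy (tree_upto N) \<phi> (trunc N (fst \<zeta>)) (trunc N (snd \<zeta>))
     = (\<Sum>u\<in>tree_upto N. \<Sum>v\<in>tree_upto N. indicator (Sset (u, v)) \<zeta> * \<phi> u v)" for \<zeta>
    unfolding hardy_def
    by (intro sum.cong refl) (auto simp: Sset_Times below_def le_Vert_iff_trunc indicator_def mem_Times_iff)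
  show ?thesis unfolding * by measurable
qed

lemma level_set_bound:
  fixes \<nu> :: "(tbar \<times> tbar) measure"
  assumes Q: "cap_sup \<nu> < top"
    and E: "E \<subseteq> tree_upto N \<times> tree_upto N" and ch: "charge (tree_upto N) \<mu>"
    and V: "\<And>a b. (a, b) \<in> E \<Longrightarrow> 1 \<le> hardy (tree_upto N) (adjoint (tree_upto N) \<mu>) a b"
  shows "emeasure \<nu> (\<Union>\<alpha>\<in>E. Sset \<alpha>) \<le> cap_sup \<nu> * ennreal (mass (tree_upto N) \<mu>)"
proof (cases "E = {}")
  case False
  have "finite E" using E by (rule finite_subset) simp
  show ?thesis
    by (rule le_times_of_divide_le[OF quotient_le_cap_sup[OF \<open>finite E\<close> False] Cap_le_mass[OF E ch V] Q])
qed simp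

text \<open>
  On finitely many levels the potential of \<open>\<phi>\<close> takes finitely many values, so finitely many
  levels \<open>c * 4 ^ k\<close> suffice, \<open>c\<close> being a lower bound for the positive values. The level
  sets are finite unions of rectangles; their \<open>\<nu>\<close>-measures are controlled by the masses of
  equilibrium charges, whose weighted sum is controlled by \<open>strong_capacitary\<close>. The constant is
  \<open>16 * 20\<close>.
\<close>

lemma truncated_embedding:
  fixes \<nu> :: "(tbar \<times> tbar) measure" and \<phi> :: "vertex \<Rightarrow> vertex \<Rightarrow> real"
  assumes sets: "sets \<nu> = sets borel" and Q: "cap_sup \<nu> < top" and \<phi>: "\<And>a b. 0 \<le> \<phi> a b"
  shows "(\<integral>\<^sup>+\<zeta>. (ennreal (hardy (tree_upto N) \<phi> (trunc N (fst \<zeta>)) (trunc N (snd \<zeta>))))\<^sup>2 \<partial>\<nu>)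
    \<le> 320 * cap_sup \<nu> * ennreal (sq_norm (tree_upto N) \<phi>)"
proof -
  let ?A = "tree_upto N"
  let ?V = "hardy ?A \<phi>"
  define W where "W \<zeta> = ?V (trunc N (fst \<zeta>)) (trunc N (snd \<zeta>))" for \<zeta>
  have V0: "0 \<le> ?V a b" for a b by (rule hardy_nonneg[OF \<phi>])
  define R where "R = (\<lambda>p. ?V (fst p) (snd p)) ` (?A \<times> ?A)"
  have finR: "finite R" by (simp add: R_def)
  obtain c where c: "0 < c" "\<And>r. r \<in> R \<Longrightarrow> r = 0 \<or> c \<le> r"
  proof -
    \<comment> \<open>The element 1 keeps the set nonempty when all values are 0.\<close>
    define c where "c = Min (insert 1 {r\<in>R. 0 < r})"
    have "c \<in> insert 1 {r\<in>R. 0 < r}" unfolding c_def using finR by (intro Min_in) auto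
    then have "0 < c" by auto
    moreover have "r = 0 \<or> c \<le> r" if "r \<in> R" for r
    proof (cases "r = 0")
      case False
      moreover have "0 \<le> r" using that V0 by (auto simp: R_def)
      ultimately show ?thesis unfolding c_def using finR that by (intro disjI2 Min_le) auto
    qed simp
    ultimately show thesis by (rule that)
  qed
  obtain n where n: "\<And>r. r \<in> R \<Longrightarrow> r < c * 4 ^ n"
  proof -
    obtain n where "(\<Sum>r\<in>R. r) / c < 4 ^ n" using real_arch_pow[of 4] by auto
    then have *: "(\<Sum>r\<in>R. r) < c * 4 ^ n" using c(1) by (simp add: field_simps)
    have "r \<le> (\<Sum>r\<in>R. r)" if "r \<in> R" for r
      using finR that V0 by (intro member_le_sum) (auto simp: R_def)
    with * show thesis by (intro that[of n]) force
  qed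
  define E where "E k = {p \<in> ?A \<times> ?A. c * 4 ^ k \<le> ?V (fst p) (snd p)}" for k :: nat
  have E: "E k \<subseteq> ?A \<times> ?A" for k by (auto simp: E_def)
  have "\<exists>\<mu>. charge ?A \<mu> \<and> (\<forall>a b. \<mu> a b \<noteq> 0 \<longrightarrow> (a, b) \<in> E k) \<and>
      (\<forall>a b. (a, b) \<in> E k \<longrightarrow> 1 \<le> hardy ?A (adjoint ?A \<mu>) a b)" for k
    by (rule equilibrium[OF finite_tree_upto E[of k]]) blast
  then obtain \<mu> where ch: "\<And>k. charge ?A (\<mu> k)" and supp: "\<And>k a b. \<mu> k a b \<noteq> 0 \<Longrightarrow> (a, b) \<in> E k"
    and V1: "\<And>k a b. (a, b) \<in> E k \<Longrightarrow> 1 \<le> hardy ?A (adjoint ?A (\<mu> k)) a b"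
    by metis
  define U where "U k = (\<Union>\<alpha>\<in>E k. Sset \<alpha>)" for k
  have U [measurable]: "U k \<in> sets \<nu>" for k
    unfolding U_def sets by (intro sets.finite_UN finite_subset[OF E] Sset_borel) simp
  have pw: "(ennreal (W \<zeta>))\<^sup>2 \<le> (\<Sum>k<n. ennreal (16 * (c * 4 ^ k)\<^sup>2) * indicator (U k) \<zeta>)" for \<zeta>
  proof -
    let ?p = "(trunc N (fst \<zeta>), trunc N (snd \<zeta>))"
    have p: "?p \<in> ?A \<times> ?A" by (simp add: trunc_tree_upto)
    then have WR: "W \<zeta> \<in> R" unfolding R_def W_def by force
    have "\<zeta> \<in> Sset ?p" by (simp add: Sset_Times mem_Times_iff le_trunc)
    then have U: "\<zeta> \<in> U k" if "c * 4 ^ k \<le> W \<zeta>" for k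
      using p that by (auto simp: U_def E_def W_def)
    have "(ennreal (W \<zeta>))\<^sup>2 = ennreal ((W \<zeta>)\<^sup>2)"
      by (simp add: ennreal_power W_def V0)
    also have "\<dots> \<le> ennreal (\<Sum>k<n. 16 * (c * 4 ^ k)\<^sup>2 * of_bool (c * 4 ^ k \<le> W \<zeta>))"
      using WR c n by (intro ennreal_leI layer_cake) auto
    also have "\<dots> \<le> ennreal (\<Sum>k<n. 16 * (c * 4 ^ k)\<^sup>2 * indicator (U k) \<zeta>)"
      using U by (intro ennreal_leI sum_mono mult_left_mono) (auto simp: indicator_def)
    also have "\<dots> = (\<Sum>k<n. ennreal (16 * (c * 4 ^ k)\<^sup>2) * indicator (U k) \<zeta>)"
      by (subst sum_ennreal[symmetric]) (auto simp: indicator_def intro!: sum.cong)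
    finally show ?thesis .
  qed
  have "(\<integral>\<^sup>+\<zeta>. (ennreal (W \<zeta>))\<^sup>2 \<partial>\<nu>) \<le> (\<integral>\<^sup>+\<zeta>. (\<Sum>k<n. ennreal (16 * (c * 4 ^ k)\<^sup>2) * indicator (U k) \<zeta>) \<partial>\<nu>)"
    by (intro nn_integral_mono pw)
  also have "\<dots> = (\<Sum>k<n. ennreal (16 * (c * 4 ^ k)\<^sup>2) * emeasure \<nu> (U k))"
    by (subst nn_integral_sum) (auto simp: nn_integral_cmult_indicator)
  also have "\<dots> \<le> (\<Sum>k<n. ennreal (16 * (c * 4 ^ k)\<^sup>2) * (cap_sup \<nu> * ennreal (mass ?A (\<mu> k))))"
    unfolding U_def by (intro sum_mono mult_left_mono level_set_bound[OF Q E ch V1]) auto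
  also have "\<dots> = cap_sup \<nu> * (\<Sum>k<n. ennreal (16 * (c * 4 ^ k)\<^sup>2 * mass ?A (\<mu> k)))"
    using charge.nonneg[OF ch]
    by (simp add: sum_distrib_left ennreal_mult mass_def sum_nonneg mult_ac)
  also have "(\<Sum>k<n. ennreal (16 * (c * 4 ^ k)\<^sup>2 * mass ?A (\<mu> k))) = ennreal (16 * (\<Sum>k<n. (c * 4 ^ k)\<^sup>2 * mass ?A (\<mu> k)))"
    using charge.nonneg[OF ch]
    by (subst sum_ennreal) (auto simp: sum_distrib_left mass_def mult_ac intro!: sum_nonneg mult_nonneg_nonneg)
  also have "\<dots> \<le> ennreal (320 * sq_norm ?A \<phi>)"
    using strong_capacitary[of c ?A \<mu> \<phi> n] c(1) ch supp by (intro ennreal_leI) (fastforce simp: E_def)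
  also have "ennreal (320 * sq_norm ?A \<phi>) = 320 * ennreal (sq_norm ?A \<phi>)"
    by (simp add: ennreal_mult sq_norm_def sum_nonneg)
  finally show ?thesis
    unfolding W_def by (simp add: mult_left_mono) (simp add: mult_ac)
qed

lemma SUP_square:
  fixes f :: "nat \<Rightarrow> ennreal"
  assumes "incseq f"
  shows "(SUP n. f n)\<^sup>2 = (SUP n. (f n)\<^sup>2)"
proof (rule antisym)
  have "(SUP n. f n)\<^sup>2 = (SUP j. SUP i. f i * f j)"
    by (simp add: power2_eq_square SUP_mult_left_ennreal SUP_mult_right_ennreal)
  also have "\<dots> \<le> (SUP n. (f n)\<^sup>2)"
  proof (intro SUP_least)
    fix i j
    have "f i * f j \<le> (f (max i j))\<^sup>2"
      unfolding power2_eq_square by (intro mult_mono incseqD[OF assms]) auto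
    then show "f i * f j \<le> (SUP n. (f n)\<^sup>2)" by (rule SUP_upper2[OF UNIV_I])
  qed
  finally show "(SUP n. f n)\<^sup>2 \<le> (SUP n. (f n)\<^sup>2)" .
  show "(SUP n. (f n)\<^sup>2) \<le> (SUP n. f n)\<^sup>2"
    by (intro SUP_least power_mono SUP_upper) auto
qed

lemma trunc_mono: "M \<le> N \<Longrightarrow> prefix (trunc M x) (trunc N x)"
proof (cases x)
  case (Vert a)
  then show "M \<le> N \<Longrightarrow> prefix (trunc M x) (trunc N x)"
    using take_is_prefix[of M "take N a"] by (simp add: min.absorb1)
qed (auto simp: prefix_desc_iff)

lemma incseq_trunc:
  assumes "\<And>a b. 0 \<le> \<phi> a b"
  shows "incseq (\<lambda>N. ennreal (hardy (tree_upto N) \<phi> (trunc N x) (trunc N y)))"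
proof (rule incseq_SucI, rule ennreal_leI)
  fix N
  have sub: "tree_upto N \<subseteq> tree_upto (Suc N)" by (auto simp: tree_upto_def)
  have "hardy (tree_upto N) \<phi> (trunc N x) (trunc N y) \<le> hardy (tree_upto N) \<phi> (trunc (Suc N) x) (trunc (Suc N) y)"
    using assms by (intro hardy_prefix trunc_mono) auto
  also have "\<dots> \<le> hardy (tree_upto (Suc N)) \<phi> (trunc (Suc N) x) (trunc (Suc N) y)"
  proof -
    have "hardy (tree_upto N) \<phi> a b \<le> (\<Sum>u\<in>tree_upto N. \<Sum>v\<in>tree_upto (Suc N). below u a * below v b * \<phi> u v)" for a b
      unfolding hardy_def using sub assms by (intro sum_mono sum_mono2) auto
    also have "\<dots> a b \<le> hardy (tree_upto (Suc N)) \<phi> a b" for a b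
      unfolding hardy_def using sub assms by (intro sum_mono2) (auto intro!: sum_nonneg)
    finally show ?thesis .
  qed
  finally show "hardy (tree_upto N) \<phi> (trunc N x) (trunc N y) \<le> hardy (tree_upto (Suc N)) \<phi> (trunc (Suc N) x) (trunc (Suc N) y)" .
qed

lemma embedding:
  fixes \<nu> :: "(tbar \<times> tbar) measure"
  assumes sets: "sets \<nu> = sets borel" and Q: "cap_sup \<nu> < top" and \<phi>: "\<And>\<alpha>. 0 \<le> \<phi> \<alpha>"
  shows "(\<integral>\<^sup>+\<zeta>. (Iop \<phi> \<zeta>)\<^sup>2 \<partial>\<nu>) \<le> 320 * cap_sup \<nu> * l2_norm_sq \<phi>"
proof -
  let ?W = "\<lambda>N \<zeta>. ennreal (hardy (tree_upto N) (curry \<phi>) (trunc N (fst \<zeta>)) (trunc N (snd \<zeta>)))"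
  have inc: "incseq (\<lambda>N. ?W N \<zeta>)" for \<zeta>
    using \<phi> by (intro incseq_trunc) simp
  have "(Iop \<phi> \<zeta>)\<^sup>2 = (SUP N. (?W N \<zeta>)\<^sup>2)" for \<zeta>
    using Iop_eq[of \<phi> "fst \<zeta>" "snd \<zeta>"] \<phi> SUP_square[OF inc[of \<zeta>]] by simp
  then have "(\<integral>\<^sup>+\<zeta>. (Iop \<phi> \<zeta>)\<^sup>2 \<partial>\<nu>) = (\<integral>\<^sup>+\<zeta>. (SUP N. (?W N \<zeta>)\<^sup>2) \<partial>\<nu>)" by simp
  also have "\<dots> = (SUP N. \<integral>\<^sup>+\<zeta>. (?W N \<zeta>)\<^sup>2 \<partial>\<nu>)"
  proof (rule nn_integral_monotone_convergence_SUP)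
    show "incseq (\<lambda>N \<zeta>. (?W N \<zeta>)\<^sup>2)"
      using incseqD[OF inc] by (auto simp: incseq_def le_fun_def intro!: power_mono)
    show "(\<lambda>\<zeta>. (?W N \<zeta>)\<^sup>2) \<in> borel_measurable \<nu>" for N
      unfolding measurable_cong_sets[OF sets refl] by measurable
  qed
  also have "\<dots> \<le> 320 * cap_sup \<nu> * l2_norm_sq \<phi>"
  proof (rule SUP_least)
    fix N
    have "(\<integral>\<^sup>+\<zeta>. (?W N \<zeta>)\<^sup>2 \<partial>\<nu>) \<le> 320 * cap_sup \<nu> * ennreal (sq_norm (tree_upto N) (curry \<phi>))"
      using \<phi> by (intro truncated_embedding[OF sets Q]) simp
    also have "\<dots> \<le> 320 * cap_sup \<nu> * l2_norm_sq \<phi>"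
      unfolding l2_norm_sq_eq by (intro mult_left_mono SUP_upper) auto
    finally show "(\<integral>\<^sup>+\<zeta>. (?W N \<zeta>)\<^sup>2 \<partial>\<nu>) \<le> 320 * cap_sup \<nu> * l2_norm_sq \<phi>" .
  qed
  finally show ?thesis .
qed

lemma I_norm_sq_le:
  fixes \<nu> :: "(tbar \<times> tbar) measure"
  assumes "sets \<nu> = sets borel"
  shows "I_norm_sq \<nu> \<le> 320 * cap_sup \<nu>"
proof (cases "cap_sup \<nu> = top")
  case False
  then show ?thesis
    unfolding I_norm_sq_def using assms embedding by (intro Inf_lower) (auto simp: less_top)
qed (simp add: ennreal_mult_top)

section \<open>Passing from boundary rectangles to full rectangles\<close>

text \<open>
  Sums over the infinite tree are integrals for the counting measure, which gives access to
  Fubini's theorem and the Cauchy-Schwarz inequality for them.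
\<close>

abbreviation csum :: "('a \<Rightarrow> ennreal) \<Rightarrow> ennreal" where
  "csum f \<equiv> (\<integral>\<^sup>+x. f x \<partial>count_space UNIV)"

text \<open>
  The weight \<open>q ^ n\<close> of an \<open>n\<close>-th generation descendant \<open>u'\<close> of \<open>u\<close>. There are \<open>2 ^ n\<close> of them, so
  the weights sum to a finite value over descendants for \<open>q < 1/2\<close> and over ancestors for
  \<open>q < 1\<close>.
\<close>

definition path_weight :: "real \<Rightarrow> vertex \<Rightarrow> vertex \<Rightarrow> ennreal" where
  "path_weight q u u' = (if prefix u u' then ennreal (q ^ (length u' - length u)) else 0)"

lemma path_weight_mult: "0 \<le> q \<Longrightarrow> 0 \<le> r \<Longrightarrow> path_weight q u u' * path_weight r u u' = path_weight (q * r) u u'"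
  by (simp add: path_weight_def power_mult_distrib ennreal_mult)

lemma path_weight_ancestors: "csum (\<lambda>u. path_weight (9/16) u u') \<le> ennreal (16/7)"
proof -
  have "(\<Sum>u\<in>set (prefixes x). (9/16::real) ^ (length x - length u)) \<le> 16/7" for x :: vertex
  proof (induction x rule: rev_induct)
    case (snoc b x)
    have "(\<Sum>u\<in>set (prefixes (x @ [b])). (9/16::real) ^ (length (x @ [b]) - length u))
        = 1 + (\<Sum>u\<in>set (prefixes x). (9/16) ^ (Suc (length x) - length u))"
      by (subst prefixes_snoc) (simp add: sum.insert)
    also have "(\<Sum>u\<in>set (prefixes x). (9/16::real) ^ (Suc (length x) - length u))
        = (\<Sum>u\<in>set (prefixes x). 9/16 * (9/16) ^ (length x - length u))"
      by (intro sum.cong refl) (auto dest!: prefix_length_le simp: Suc_diff_le)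
    also have "\<dots> = 9/16 * (\<Sum>u\<in>set (prefixes x). (9/16) ^ (length x - length u))"
      by (simp add: sum_distrib_left)
    finally show ?case using snoc by simp
  qed simp
  moreover have "csum (\<lambda>u. path_weight (9/16) u u') = (\<Sum>u\<in>set (prefixes u'). path_weight (9/16) u u')"
    by (rule nn_integral_count_space') (auto simp: path_weight_def)
  moreover have "\<dots> = ennreal (\<Sum>u\<in>set (prefixes u'). (9/16) ^ (length u' - length u))"
    by (subst sum_ennreal[symmetric]) (auto simp: path_weight_def intro!: sum.cong)
  ultimately show ?thesis by (simp add: ennreal_leI)
qed

lemma path_weight_descendants: "csum (\<lambda>u'. path_weight (4/9) u u') = 9"
proof -
  have "csum (\<lambda>u'. path_weight (4/9) u u') = (\<integral>\<^sup>+u'. ennreal ((4/9) ^ (length u' - length u)) \<partial>count_space {u'. prefix u u'})"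
    by (subst nn_integral_count_space_indicator) (auto intro!: nn_integral_cong simp: path_weight_def)
  also have "\<dots> = csum (\<lambda>z::vertex. ennreal ((4/9) ^ length z))"
  proof -
    have "bij_betw (\<lambda>z. u @ z) UNIV {u'. prefix u u'}"
      by (auto simp: bij_betw_def inj_on_def prefix_def)
    from nn_integral_bij_count_space[OF this, of "\<lambda>u'. ennreal ((4/9) ^ (length u' - length u))"]
    show ?thesis by simp
  qed
  also have "\<dots> = csum (\<lambda>z::vertex. csum (\<lambda>n. ennreal ((4/9) ^ n) * indicator {z. length z = n} z))"
  proof (intro nn_integral_cong)
    fix z :: vertex
    show "ennreal ((4/9) ^ length z) = csum (\<lambda>n. ennreal ((4/9) ^ n) * indicator {z. length z = n} z)"
      by (subst nn_integral_count_space'[where A = "{length z}"]) auto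
  qed
  also have "\<dots> = csum (\<lambda>n. csum (\<lambda>z::vertex. ennreal ((4/9) ^ n) * indicator {z. length z = n} z))"
    by (rule nn_integral_count_space_nn_integral) auto
  also have "\<dots> = csum (\<lambda>n. ennreal ((8/9) ^ n))"
  proof (intro nn_integral_cong)
    fix n :: nat
    have "card {z::vertex. length z = n} = 2 ^ n" "finite {z::vertex. length z = n}"
      using card_lists_length_eq[of "UNIV :: bool set" n] finite_lists_length_eq[of "UNIV :: bool set" n] by auto
    then have "csum (\<lambda>z::vertex. ennreal ((4/9) ^ n) * indicator {z. length z = n} z) = ennreal ((4/9) ^ n) * ennreal (2 ^ n)"
      by (subst nn_integral_cmult_indicator) (auto simp: ennreal_of_nat_eq_real_of_nat)
    also have "\<dots> = ennreal ((8/9) ^ n)"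
      by (simp flip: ennreal_mult power_mult_distrib)
    finally show "csum (\<lambda>z::vertex. ennreal ((4/9) ^ n) * indicator {z. length z = n} z) = ennreal ((8/9) ^ n)" .
  qed
  also have "\<dots> = (\<Sum>n. ennreal ((8/9) ^ n))" by (rule nn_integral_count_space_nat)
  also have "\<dots> = ennreal (\<Sum>n. (8/9) ^ n)" by (rule suminf_ennreal2) auto
  also have "\<dots> = 9" by (simp add: suminf_geometric)
  finally show ?thesis .
qed

text \<open>
  With the weight \<open>1/2\<close>, each descendant counts with the probability that a random path from \<open>u\<close>
  goes through it.
\<close>

definition smear :: "(vertex \<Rightarrow> ennreal) \<Rightarrow> vertex \<Rightarrow> ennreal" where
  "smear h u = csum (\<lambda>u'. path_weight (1/2) u u' * h u')"

text \<open>
  Split \<open>1/2 = 3/4 * 2/3\<close> in the Cauchy-Schwarz inequality: \<open>(2/3)\<^sup>2 = 4/9\<close> is below \<open>1/2\<close>, so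
  the weights sum over descendants, and \<open>(3/4)\<^sup>2 = 9/16\<close> is below 1, so after interchanging the
  sums the remaining weights sum over ancestors.
\<close>

lemma smear_l2: "csum (\<lambda>u. (smear h u)\<^sup>2) \<le> ennreal (144/7) * csum (\<lambda>u. (h u)\<^sup>2)"
proof -
  have "(smear h u)\<^sup>2 \<le> csum (\<lambda>u'. path_weight (9/16) u u' * (h u')\<^sup>2) * 9" for u
  proof -
    have "path_weight (1/2) u u' * h u' = (path_weight (3/4) u u' * h u') * path_weight (2/3) u u'" for u'
      using path_weight_mult[of "3/4" "2/3" u u'] by (simp add: mult_ac)
    then have "(smear h u)\<^sup>2 \<le> csum (\<lambda>u'. (path_weight (3/4) u u' * h u')\<^sup>2) * csum (\<lambda>u'. (path_weight (2/3) u u')\<^sup>2)"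
      unfolding smear_def by (simp only:) (rule Cauchy_Schwarz_nn_integral, simp_all)
    also have "\<dots> = csum (\<lambda>u'. path_weight (9/16) u u' * (h u')\<^sup>2) * csum (\<lambda>u'. path_weight (4/9) u u')"
      using path_weight_mult[of "3/4" "3/4" u] path_weight_mult[of "2/3" "2/3" u]
      by (simp add: power_mult_distrib power2_eq_square mult_ac)
    finally show ?thesis by (simp add: path_weight_descendants)
  qed
  then have "csum (\<lambda>u. (smear h u)\<^sup>2) \<le> csum (\<lambda>u. csum (\<lambda>u'. path_weight (9/16) u u' * (h u')\<^sup>2) * 9)"
    by (intro nn_integral_mono)
  also have "\<dots> = csum (\<lambda>u. csum (\<lambda>u'. path_weight (9/16) u u' * (h u')\<^sup>2)) * 9"
    by (rule nn_integral_multc) simp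
  also have "csum (\<lambda>u. csum (\<lambda>u'. path_weight (9/16) u u' * (h u')\<^sup>2)) = csum (\<lambda>u'. csum (\<lambda>u. path_weight (9/16) u u' * (h u')\<^sup>2))"
    by (rule nn_integral_count_space_nn_integral) auto
  also have "\<dots> = csum (\<lambda>u'. csum (\<lambda>u. path_weight (9/16) u u') * (h u')\<^sup>2)"
    by (simp add: nn_integral_multc)
  also have "\<dots> \<le> csum (\<lambda>u'. ennreal (16/7) * (h u')\<^sup>2)"
    by (intro nn_integral_mono mult_right_mono path_weight_ancestors) auto
  also have "\<dots> = ennreal (16/7) * csum (\<lambda>u'. (h u')\<^sup>2)"
    by (rule nn_integral_cmult) simp
  also have "\<dots> * 9 = ennreal (16/7 * 9) * csum (\<lambda>u'. (h u')\<^sup>2)"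
    by (subst ennreal_mult) (auto simp: mult_ac)
  finally show ?thesis by (simp add: mult_right_mono)
qed

definition smear2 :: "(vertex \<Rightarrow> vertex \<Rightarrow> ennreal) \<Rightarrow> vertex \<Rightarrow> vertex \<Rightarrow> ennreal" where
  "smear2 \<Phi> x y = smear (\<lambda>u. smear (\<Phi> u) y) x"

lemma smear2_l2: "csum (\<lambda>x. csum (\<lambda>y. (smear2 \<Phi> x y)\<^sup>2)) \<le> ennreal ((144/7)\<^sup>2) * csum (\<lambda>u. csum (\<lambda>v. (\<Phi> u v)\<^sup>2))"
proof -
  let ?K = "ennreal (144/7)"
  have "csum (\<lambda>x. csum (\<lambda>y. (smear2 \<Phi> x y)\<^sup>2)) = csum (\<lambda>y. csum (\<lambda>x. (smear2 \<Phi> x y)\<^sup>2))"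
    by (rule nn_integral_count_space_nn_integral) auto
  also have "\<dots> \<le> csum (\<lambda>y. ?K * csum (\<lambda>u. (smear (\<Phi> u) y)\<^sup>2))"
    unfolding smear2_def by (intro nn_integral_mono smear_l2)
  also have "\<dots> = ?K * csum (\<lambda>y. csum (\<lambda>u. (smear (\<Phi> u) y)\<^sup>2))"
    by (rule nn_integral_cmult) simp
  also have "csum (\<lambda>y. csum (\<lambda>u. (smear (\<Phi> u) y)\<^sup>2)) = csum (\<lambda>u. csum (\<lambda>y. (smear (\<Phi> u) y)\<^sup>2))"
    by (rule nn_integral_count_space_nn_integral) auto
  also have "?K * \<dots> \<le> ?K * csum (\<lambda>u. ?K * csum (\<lambda>v. (\<Phi> u v)\<^sup>2))"
    by (intro mult_left_mono nn_integral_mono smear_l2) auto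
  also have "\<dots> = (?K * ?K) * csum (\<lambda>u. csum (\<lambda>v. (\<Phi> u v)\<^sup>2))"
    by (subst nn_integral_cmult) (auto simp: mult_ac)
  also have "?K * ?K = ennreal ((144/7)\<^sup>2)"
    by (subst ennreal_mult[symmetric]) (auto simp: power2_eq_square)
  finally show ?thesis .
qed

text \<open>
  The probability that a random path through \<open>a\<close>, which takes either child with probability \<open>1/2\<close>
  at each step below \<open>a\<close>, goes through \<open>u\<close>. For ancestors \<open>u\<close> of \<open>a\<close> the truncated difference of
  lengths is 0 and the probability is 1.
\<close>

definition path_prob :: "vertex \<Rightarrow> vertex \<Rightarrow> ennreal" where
  "path_prob a u = (if prefix u a \<or> prefix a u then ennreal ((1/2) ^ (length u - length a)) else 0)"

definition expect :: "(vertex \<Rightarrow> ennreal) \<Rightarrow> vertex \<Rightarrow> ennreal" where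
  "expect h a = csum (\<lambda>u. path_prob a u * h u)"

lemma path_prob_children: "path_prob a u = (path_prob (a @ [False]) u + path_prob (a @ [True]) u) / 2"
proof (cases "prefix u a")
  case True
  then have "length u - length a = 0" "length u - Suc (length a) = 0" "prefix u (a @ [x])" for x
    using prefix_length_le[OF True] True by auto
  with True show ?thesis by (simp add: path_prob_def)
next
  case nu: False
  show ?thesis
  proof (cases "prefix a u")
    case True
    then obtain x z where u: "u = a @ x # z"
      using nu by (auto simp: prefix_def) (metis append_Nil2 neq_Nil_conv)
    have "ennreal (2 * r) / 2 = ennreal r" if "0 \<le> r" for r
      using that by (simp add: ennreal_mult' mult.commute ennreal_mult_divide_eq flip: ennreal_numeral)
    from this[of "(1/2) ^ Suc (length z)"] show ?thesis
      by (cases x) (auto simp: path_prob_def u)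
  next
    case False
    have "\<not> prefix u (a @ [x])" "\<not> prefix (a @ [x]) u" for x
      using nu False by (auto dest: append_prefixD)
    with nu False show ?thesis by (simp add: path_prob_def)
  qed
qed

lemma expect_children: "expect h a = (expect h (a @ [False]) + expect h (a @ [True])) / 2"
proof -
  have "expect h a = csum (\<lambda>u. (path_prob (a @ [False]) u * h u + path_prob (a @ [True]) u * h u) * inverse 2)"
    unfolding expect_def path_prob_children[of a] divide_ennreal_def
    by (simp only: distrib_right mult.assoc mult.commute[of "inverse 2"])
  also have "\<dots> = (expect h (a @ [False]) + expect h (a @ [True])) * inverse 2"
    unfolding expect_def by (simp add: nn_integral_multc nn_integral_add)
  finally show ?thesis by (simp add: divide_ennreal_def)
qed

lemma half_sum_ge: "x \<le> (x + y) / 2 \<or> y \<le> (x + y) / (2::ennreal)"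
proof -
  have *: "x \<le> (x + y) / 2" if "x \<le> y" for x y :: ennreal
  proof -
    have "x = (x + x) / 2" by (simp add: ennreal_mult_divide_eq flip: mult_2_right)
    also have "\<dots> \<le> (x + y) / 2" using that by (intro divide_right_mono_ennreal add_left_mono)
    finally show ?thesis .
  qed
  show ?thesis using *[of x y] *[of y x] by (cases "x \<le> y") (auto simp: add.commute)
qed

lemma expect_child: "\<exists>c. expect h (a @ [c]) \<le> expect h a"
  using half_sum_ge[of "expect h (a @ [False])" "expect h (a @ [True])"] expect_children[of h a] by metis

definition expect2 :: "(vertex \<Rightarrow> vertex \<Rightarrow> ennreal) \<Rightarrow> vertex \<Rightarrow> vertex \<Rightarrow> ennreal" where
  "expect2 \<Phi> a b = expect (\<lambda>u. expect (\<Phi> u) b) a"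

text \<open>
  In this form \<open>expect_child\<close> applies to the second coordinate.
\<close>

lemma expect2_swap: "expect2 \<Phi> a b = expect (\<lambda>v. expect (\<lambda>u. \<Phi> u v) a) b"
proof -
  have "expect2 \<Phi> a b = csum (\<lambda>u. csum (\<lambda>v. path_prob a u * (path_prob b v * \<Phi> u v)))"
    unfolding expect2_def expect_def by (simp add: nn_integral_cmult)
  also have "\<dots> = csum (\<lambda>v. csum (\<lambda>u. path_prob a u * (path_prob b v * \<Phi> u v)))"
    by (rule nn_integral_count_space_nn_integral) auto
  also have "\<dots> = expect (\<lambda>v. expect (\<lambda>u. \<Phi> u v) a) b"
  proof -
    have *: "path_prob a u * (path_prob b v * \<Phi> u v) = path_prob b v * (path_prob a u * \<Phi> u v)" for u v
      by (rule mult.left_commute)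
    show ?thesis unfolding expect_def * by (simp add: nn_integral_cmult)
  qed
  finally show ?thesis .
qed

lemma smear_mono: "(\<And>u. h u \<le> k u) \<Longrightarrow> smear h a \<le> smear k a"
  unfolding smear_def by (auto intro!: nn_integral_mono mult_left_mono)

lemma sum_le_expect:
  assumes "finite A"
  shows "(\<Sum>u\<in>A. ennreal (below u a) * h u) \<le> expect h a"
proof -
  have "(\<Sum>u\<in>A. ennreal (below u a) * h u) = (\<integral>\<^sup>+u. ennreal (below u a) * h u \<partial>count_space A)"
    using assms by (simp add: nn_integral_count_space_finite)
  also have "\<dots> = csum (\<lambda>u. ennreal (below u a) * h u * indicator A u)"
    by (rule nn_integral_count_space_indicator) simp
  also have "\<dots> \<le> expect h a"
    unfolding expect_def
    by (intro nn_integral_mono) (auto simp: below_def path_prob_def indicator_def dest: prefix_length_le)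
  finally show ?thesis .
qed

text \<open>
  The path from the root to \<open>a\<close> contains an ancestor \<open>x\<close> of \<open>u\<close> with \<open>path_weight (1/2) x u = path_prob a u\<close>,
  namely \<open>u\<close> itself or \<open>a\<close>.
\<close>

lemma expect_le_sum:
  assumes A: "finite A" "set (prefixes a) \<subseteq> A"
  shows "expect h a \<le> (\<Sum>x\<in>A. ennreal (below x a) * smear h x)"
proof -
  have "path_prob a u \<le> (\<Sum>x\<in>A. ennreal (below x a) * path_weight (1/2) x u)" for u
  proof -
    let ?t = "\<lambda>x. ennreal (below x a) * path_weight (1/2) x u"
    have "?t x \<le> sum ?t A" if "x \<in> A" for x
      using A that by (intro member_le_sum) auto
    moreover have "path_prob a u \<le> ?t (if prefix u a then u else a)"
      by (auto simp: path_prob_def path_weight_def below_def dest: prefix_length_le)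
    moreover have "(if prefix u a then u else a) \<in> A" using A(2) by auto
    ultimately show ?thesis using order_trans by blast
  qed
  then have "expect h a \<le> csum (\<lambda>u. (\<Sum>x\<in>A. ennreal (below x a) * path_weight (1/2) x u) * h u)"
    unfolding expect_def by (intro nn_integral_mono mult_right_mono) auto
  also have "\<dots> = (\<Sum>x\<in>A. ennreal (below x a) * smear h x)"
    unfolding smear_def by (simp add: sum_distrib_right mult.assoc nn_integral_sum nn_integral_cmult)
  finally show ?thesis .
qed

lemma smear_sum: "smear (\<lambda>u. \<Sum>y\<in>A. c y * \<Phi> u y) x = (\<Sum>y\<in>A. c y * smear (\<lambda>u. \<Phi> u y) x)"
  unfolding smear_def by (simp add: sum_distrib_left mult.left_commute nn_integral_sum nn_integral_cmult)

lemma sum_le_expect2: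
  assumes "finite A"
  shows "(\<Sum>u\<in>A. \<Sum>v\<in>A. ennreal (below u a) * ennreal (below v b) * \<Phi> u v) \<le> expect2 \<Phi> a b"
proof -
  have "(\<Sum>u\<in>A. \<Sum>v\<in>A. ennreal (below u a) * ennreal (below v b) * \<Phi> u v)
      = (\<Sum>u\<in>A. ennreal (below u a) * (\<Sum>v\<in>A. ennreal (below v b) * \<Phi> u v))"
    by (simp add: sum_distrib_left mult.assoc)
  also have "\<dots> \<le> (\<Sum>u\<in>A. ennreal (below u a) * expect (\<Phi> u) b)"
    by (intro sum_mono mult_left_mono sum_le_expect assms) auto
  also have "\<dots> \<le> expect2 \<Phi> a b"
    unfolding expect2_def by (rule sum_le_expect[OF assms])
  finally show ?thesis .
qed

lemma expect2_le_sum: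
  assumes "finite A" "set (prefixes a) \<subseteq> A" "set (prefixes b) \<subseteq> A"
  shows "expect2 \<Phi> a b \<le> (\<Sum>x\<in>A. \<Sum>y\<in>A. ennreal (below x a) * ennreal (below y b) * smear2 \<Phi> x y)"
proof -
  have "expect2 \<Phi> a b \<le> (\<Sum>x\<in>A. ennreal (below x a) * smear (\<lambda>u. expect (\<Phi> u) b) x)"
    unfolding expect2_def using assms by (intro expect_le_sum)
  also have "\<dots> \<le> (\<Sum>x\<in>A. ennreal (below x a) * smear (\<lambda>u. \<Sum>y\<in>A. ennreal (below y b) * smear (\<Phi> u) y) x)"
    using assms by (intro sum_mono mult_left_mono smear_mono expect_le_sum) auto
  also have "\<dots> = (\<Sum>x\<in>A. \<Sum>y\<in>A. ennreal (below x a) * ennreal (below y b) * smear2 \<Phi> x y)"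
    unfolding smear_sum smear2_def by (simp add: sum_distrib_left mult.assoc)
  finally show ?thesis .
qed

lemma nested_path:
  fixes A :: "nat \<Rightarrow> vertex"
  assumes "\<And>n. \<exists>c. A (Suc n) = A n @ [c]"
  obtains w where "\<And>n. desc w (length (A 0) + n) = A n"
proof -
  define L where "L = length (A 0)"
  have len: "length (A n) = L + n" for n
  proof (induction n)
    case (Suc n)
    then show ?case using assms[of n] by auto
  qed (simp add: L_def)
  have pre: "prefix (A m) (A n)" if "m \<le> n" for m n
    using that
  proof (induction rule: dec_induct)
    case (step n)
    then show ?case using assms[of n] by auto
  qed simp
  define w where "w i = A (Suc i) ! i" for i
  have nth: "A m ! i = A n ! i" if "i < length (A m)" "m \<le> n" for m n i
  proof -
    from pre[OF \<open>m \<le> n\<close>] obtain zs where "A n = A m @ zs" by (rule prefixE)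
    then show ?thesis using \<open>i < length (A m)\<close> by (simp add: nth_append)
  qed
  have "desc w (L + n) = A n" for n
  proof (rule nth_equalityI)
    fix i assume i: "i < length (desc w (L + n))"
    have "A (Suc i) ! i = A n ! i"
    proof (cases "Suc i \<le> n")
      case True
      show ?thesis by (rule nth[OF _ True]) (simp add: len)
    next
      case False
      then have "n \<le> Suc i" by simp
      from nth[OF _ this, of i] i show ?thesis by (simp add: len)
    qed
    then show "desc w (L + n) ! i = A n ! i"
      using i by (simp add: desc_def w_def)
  qed (simp add: len)
  then show thesis unfolding L_def by (rule that)
qed

text \<open>
  The method of conditional expectations: always move to a child at which the expected value is
  not larger.
\<close>

lemma minimizing_path:
  fixes F :: "vertex \<Rightarrow> vertex \<Rightarrow> ennreal"
  assumes 1: "\<And>a b. \<exists>c. F (a @ [c]) b \<le> F a b" and 2: "\<And>a b. \<exists>d. F a (b @ [d]) \<le> F a b"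
  obtains w w' where "desc w (length a) = a" "desc w' (length b) = b"
    "\<And>n. F (desc w (length a + n)) (desc w' (length b + n)) \<le> F a b"
proof -
  have "\<exists>p. (\<exists>c. fst p = a @ [c]) \<and> (\<exists>d. snd p = b @ [d]) \<and> F (fst p) (snd p) \<le> F a b" for a b
  proof -
    obtain c where "F (a @ [c]) b \<le> F a b" using 1 by blast
    moreover obtain d where "F (a @ [c]) (b @ [d]) \<le> F (a @ [c]) b" using 2 by blast
    ultimately show ?thesis by (intro exI[of _ "(a @ [c], b @ [d])"]) auto
  qed
  then obtain s where s: "\<And>a b. \<exists>c. fst (s a b) = a @ [c]" "\<And>a b. \<exists>d. snd (s a b) = b @ [d]"
    "\<And>a b. F (fst (s a b)) (snd (s a b)) \<le> F a b" by metis
  define r where "r n = ((\<lambda>p. s (fst p) (snd p)) ^^ n) (a, b)" for n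
  have r0: "r 0 = (a, b)" and rS: "r (Suc n) = s (fst (r n)) (snd (r n))" for n
    by (simp_all add: r_def)
  obtain w where w: "\<And>n. desc w (length (fst (r 0)) + n) = fst (r n)"
    by (rule nested_path[of "\<lambda>n. fst (r n)"]) (use s rS in auto)
  obtain w' where w': "\<And>n. desc w' (length (snd (r 0)) + n) = snd (r n)"
    by (rule nested_path[of "\<lambda>n. snd (r n)"]) (use s rS in auto)
  have "F (fst (r n)) (snd (r n)) \<le> F a b" for n
    by (induction n) (auto simp: r0 rS intro: order_trans[OF s(3)])
  then show thesis
    using w[of 0] w'[of 0] w w' by (intro that[of w w']) (auto simp: r0)
qed

lemma prefixes_tree_upto: "a \<in> tree_upto M \<Longrightarrow> set (prefixes a) \<subseteq> tree_upto M"
  by (auto simp: tree_upto_def dest!: prefix_length_le)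

lemma nn_integral_pairs: "csum f = (SUP N. sum f (tree_upto N \<times> tree_upto N))" for f :: "vertex \<times> vertex \<Rightarrow> ennreal"
proof -
  have "csum f = csum (\<lambda>p. SUP N. f p * indicator (tree_upto N \<times> tree_upto N) p)"
  proof (intro nn_integral_cong antisym)
    fix p :: "vertex \<times> vertex"
    show "f p \<le> (SUP N. f p * indicator (tree_upto N \<times> tree_upto N) p)"
      by (rule SUP_upper2[of "max (length (fst p)) (length (snd p))"]) (auto simp: tree_upto_def mem_Times_iff)
    show "(SUP N. f p * indicator (tree_upto N \<times> tree_upto N) p) \<le> f p"
      by (rule SUP_least) (auto simp: indicator_def)
  qed
  also have "\<dots> = (SUP N. csum (\<lambda>p. f p * indicator (tree_upto N \<times> tree_upto N) p))"
    by (rule nn_integral_monotone_convergence_SUP)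
       (auto simp: incseq_def le_fun_def tree_upto_def indicator_def)
  also have "\<dots> = (SUP N. sum f (tree_upto N \<times> tree_upto N))"
    by (simp add: nn_integral_count_space_finite flip: nn_integral_count_space_indicator)
  finally show ?thesis .
qed

lemma l2_norm_sq_csum: "l2_norm_sq \<phi> = csum (\<lambda>u. csum (\<lambda>v. ennreal ((\<phi> (u, v))\<^sup>2)))"
  unfolding l2_norm_sq_def infsum_pairs
  by (rule trans[OF nn_integral_pairs[symmetric] nn_integral_fst_count_space[symmetric]])

text \<open>
  If the expected potential on a rectangle were below 1, then so would be the potential at the end
  of the path that never increases the expectation; but this end is a boundary point.
\<close>

lemma expect2_ge_1:
  assumes \<phi>: "\<And>\<alpha>. 0 \<le> \<phi> \<alpha>" and I: "\<And>\<zeta>. \<zeta> \<in> bdSset (a, b) \<Longrightarrow> 1 \<le> Iop \<phi> \<zeta>"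
  shows "1 \<le> expect2 (\<lambda>u v. ennreal (\<phi> (u, v))) a b"
proof -
  let ?F = "expect2 (\<lambda>u v. ennreal (\<phi> (u, v)))"
  obtain w w' where w: "desc w (length a) = a" "desc w' (length b) = b"
    and F: "\<And>n. ?F (desc w (length a + n)) (desc w' (length b + n)) \<le> ?F a b"
  proof (rule minimizing_path[of ?F a b])
    show "\<exists>c. ?F (a @ [c]) b \<le> ?F a b" for a b unfolding expect2_def by (rule expect_child)
    show "\<exists>d. ?F a (b @ [d]) \<le> ?F a b" for a b unfolding expect2_swap by (rule expect_child)
  qed blast
  have "(Bdry w, Bdry w') \<in> bdSset (a, b)"
    using w by (auto simp: bdSset_def Sset_Times intro: exI[of _ "length a"] exI[of _ "length b"])
  then have "1 \<le> Iop \<phi> (Bdry w, Bdry w')" by (rule I)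
  also have "\<dots> = (SUP N. ennreal (hardy (tree_upto N) (curry \<phi>) (desc w N) (desc w' N)))"
    using Iop_eq[of \<phi> "Bdry w" "Bdry w'"] \<phi> by simp
  also have "\<dots> \<le> ?F a b"
  proof (rule SUP_least)
    fix N
    let ?a = "desc w (length a + N)" and ?b = "desc w' (length b + N)"
    have "hardy (tree_upto N) (curry \<phi>) (desc w N) (desc w' N) \<le> hardy (tree_upto N) (curry \<phi>) ?a ?b"
      using \<phi> by (intro hardy_prefix) (auto simp: prefix_desc_iff intro!: exI[of _ N])
    then have "ennreal (hardy (tree_upto N) (curry \<phi>) (desc w N) (desc w' N)) \<le> ennreal (hardy (tree_upto N) (curry \<phi>) ?a ?b)"
      by (rule ennreal_leI)
    also have "\<dots> = (\<Sum>u\<in>tree_upto N. \<Sum>v\<in>tree_upto N. ennreal (below u ?a) * ennreal (below v ?b) * ennreal (\<phi> (u, v)))"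
      using \<phi> by (simp add: hardy_def sum_nonneg ennreal_mult flip: sum_ennreal)
    also have "\<dots> \<le> ?F ?a ?b" by (rule sum_le_expect2) simp
    also have "\<dots> \<le> ?F a b" by (rule F)
    finally show "ennreal (hardy (tree_upto N) (curry \<phi>) (desc w N) (desc w' N)) \<le> ?F a b" .
  qed
  finally show ?thesis .
qed

text \<open>
  The witness \<open>\<psi>\<close> adds to each vertex the weighted values of its descendants. Its potential at a
  vertex dominates the expected potential of \<open>\<phi>\<close> at the random boundary points below it.
\<close>

lemma transfer_to_interior:
  assumes \<phi>: "\<And>\<alpha>. 0 \<le> \<phi> \<alpha>" and fin: "l2_norm_sq \<phi> < top"
    and I: "\<And>\<alpha> \<zeta>. \<alpha> \<in> E \<Longrightarrow> \<zeta> \<in> bdSset \<alpha> \<Longrightarrow> 1 \<le> Iop \<phi> \<zeta>"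
  obtains \<psi> where "\<And>\<alpha>. 0 \<le> \<psi> \<alpha>" "l2_norm_sq \<psi> \<le> ennreal ((144/7)\<^sup>2) * l2_norm_sq \<phi>"
    "\<And>a b M. (a, b) \<in> E \<Longrightarrow> a \<in> tree_upto M \<Longrightarrow> b \<in> tree_upto M \<Longrightarrow> 1 \<le> hardy (tree_upto M) (curry \<psi>) a b"
proof -
  let ?\<Phi> = "\<lambda>u v. ennreal (\<phi> (u, v))"
  let ?\<Psi> = "smear2 ?\<Phi>"
  have l2: "csum (\<lambda>x. csum (\<lambda>y. (?\<Psi> x y)\<^sup>2)) \<le> ennreal ((144/7)\<^sup>2) * l2_norm_sq \<phi>"
    using smear2_l2[of ?\<Phi>] \<phi> by (simp add: l2_norm_sq_csum ennreal_power)
  also have "\<dots> < top" using fin by (simp add: ennreal_mult_less_top)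
  finally have fin': "csum (\<lambda>x. csum (\<lambda>y. (?\<Psi> x y)\<^sup>2)) < top" .
  have \<Psi>: "?\<Psi> x y < top" for x y
  proof -
    have "(?\<Psi> x y)\<^sup>2 \<le> csum (\<lambda>y. (?\<Psi> x y)\<^sup>2)" by (rule nn_integral_ge_point) simp
    also have "\<dots> \<le> csum (\<lambda>x. csum (\<lambda>y. (?\<Psi> x y)\<^sup>2))" by (rule nn_integral_ge_point) simp
    finally show ?thesis using fin' by (auto simp: power_less_top_ennreal dest: le_less_trans)
  qed
  define \<psi> where "\<psi> \<alpha> = enn2real (?\<Psi> (fst \<alpha>) (snd \<alpha>))" for \<alpha>
  have \<psi>: "ennreal (\<psi> (x, y)) = ?\<Psi> x y" for x y using \<Psi> by (simp add: \<psi>_def)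
  have \<psi>0: "0 \<le> \<psi> \<alpha>" for \<alpha> by (simp add: \<psi>_def)
  show thesis
  proof (rule that[of \<psi>])
    show "l2_norm_sq \<psi> \<le> ennreal ((144/7)\<^sup>2) * l2_norm_sq \<phi>"
      using l2 \<psi>0 by (simp add: l2_norm_sq_csum[of \<psi>] \<psi> flip: ennreal_power)
    fix a b M assume ab: "(a, b) \<in> E" "a \<in> tree_upto M" "b \<in> tree_upto M"
    have "1 \<le> expect2 ?\<Phi> a b" by (rule expect2_ge_1[OF \<phi> I[OF ab(1)]])
    also have "\<dots> \<le> (\<Sum>x\<in>tree_upto M. \<Sum>y\<in>tree_upto M. ennreal (below x a) * ennreal (below y b) * ?\<Psi> x y)"
      using ab by (intro expect2_le_sum prefixes_tree_upto finite_tree_upto)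
    also have "\<dots> = ennreal (hardy (tree_upto M) (curry \<psi>) a b)"
      using \<psi>0 by (simp add: hardy_def sum_nonneg ennreal_mult \<psi> flip: sum_ennreal)
    finally show "1 \<le> hardy (tree_upto M) (curry \<psi>) a b" by simp
  qed (rule \<psi>0)
qed

text \<open>
  The potential of \<open>\<psi>\<close> at a single vertex is a sum with finitely many terms, so the
  Cauchy-Schwarz inequality bounds its norm below.
\<close>

lemma Cap_pos:
  assumes "\<alpha> \<in> E"
  shows "0 < Cap (\<Union>\<alpha>\<in>E. bdSset \<alpha>)"
proof -
  obtain a b where \<alpha>: "\<alpha> = (a, b)" by (cases \<alpha>)
  define M where "M = max (length a) (length b)"
  let ?A = "tree_upto M"
  define C where "C = (144/7)\<^sup>2 * (real (card ?A))\<^sup>2"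
  have ab: "a \<in> ?A" "b \<in> ?A" by (auto simp: tree_upto_def M_def)
  then have "card ?A \<noteq> 0" by auto
  then have C: "0 < C" by (simp add: C_def)
  have *: "ennreal (1 / C) \<le> l2_norm_sq \<phi>" if \<phi>: "\<And>\<alpha>. 0 \<le> \<phi> \<alpha>" and I: "\<And>\<zeta>. \<zeta> \<in> (\<Union>\<alpha>\<in>E. bdSset \<alpha>) \<Longrightarrow> 1 \<le> Iop \<phi> \<zeta>" for \<phi>
  proof (cases "l2_norm_sq \<phi> < top")
    case True
    obtain \<psi> where \<psi>: "\<And>\<alpha>. 0 \<le> \<psi> \<alpha>" "l2_norm_sq \<psi> \<le> ennreal ((144/7)\<^sup>2) * l2_norm_sq \<phi>"
      "\<And>a b M. (a, b) \<in> E \<Longrightarrow> a \<in> tree_upto M \<Longrightarrow> b \<in> tree_upto M \<Longrightarrow> 1 \<le> hardy (tree_upto M) (curry \<psi>) a b"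
      by (rule transfer_to_interior[OF \<phi> True, of E]) (use I in auto)
    have "1 \<le> hardy ?A (curry \<psi>) a b" using \<psi>(3) assms ab unfolding \<alpha> .
    then have "1 \<le> (hardy ?A (curry \<psi>) a b)\<^sup>2" by simp
    also have "\<dots> \<le> sq_norm ?A (\<lambda>u v. below u a * below v b) * sq_norm ?A (curry \<psi>)"
      unfolding hardy_def by (rule Cauchy_Schwarz)
    also have "sq_norm ?A (\<lambda>u v. below u a * below v b) \<le> (\<Sum>u\<in>?A. \<Sum>v\<in>?A. 1)"
      unfolding sq_norm_def by (intro sum_mono) (auto simp: below_def)
    also have "\<dots> = (real (card ?A))\<^sup>2" by (simp add: power2_eq_square)
    finally have "1 \<le> (real (card ?A))\<^sup>2 * sq_norm ?A (curry \<psi>)"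
      by (simp add: mult_right_mono sq_norm_def sum_nonneg)
    then have "1 \<le> ennreal ((real (card ?A))\<^sup>2 * sq_norm ?A (curry \<psi>))" by simp
    also have "\<dots> = ennreal ((real (card ?A))\<^sup>2) * ennreal (sq_norm ?A (curry \<psi>))"
      by (intro ennreal_mult) (auto simp: sq_norm_def sum_nonneg)
    also have "\<dots> \<le> ennreal ((real (card ?A))\<^sup>2) * l2_norm_sq \<psi>"
      unfolding l2_norm_sq_eq by (intro mult_left_mono SUP_upper) auto
    also have "\<dots> \<le> ennreal ((real (card ?A))\<^sup>2) * (ennreal ((144/7)\<^sup>2) * l2_norm_sq \<phi>)"
      by (intro mult_left_mono \<psi>(2)) auto
    also have "\<dots> = ennreal C * l2_norm_sq \<phi>"
      unfolding C_def by (subst ennreal_mult) (auto simp: mult_ac)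
    finally have "ennreal (1 / C) * 1 \<le> ennreal (1 / C) * (ennreal C * l2_norm_sq \<phi>)"
      by (intro mult_left_mono) auto
    also have "\<dots> = l2_norm_sq \<phi>"
      using C by (simp flip: mult.assoc ennreal_mult)
    finally show ?thesis by simp
  qed (simp add: not_less top_unique)
  have "ennreal (1 / C) \<le> Cap (\<Union>\<alpha>\<in>E. bdSset \<alpha>)"
    unfolding Cap_def by (intro INF_greatest *) blast+
  moreover have "0 < ennreal (1 / C)" using C by simp
  ultimately show ?thesis by (rule less_le_trans[rotated])
qed

text \<open>
  Test the embedding on the function given by \<open>transfer_to_interior\<close>, whose potential is at
  least 1 on the whole union of rectangles.
\<close>

lemma quotient_le:
  fixes \<nu> :: "(tbar \<times> tbar) measure"
  assumes sets: "sets \<nu> = sets borel" and E: "finite E" "E \<noteq> {}"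
    and C: "\<And>\<phi>. (\<And>\<alpha>. 0 \<le> \<phi> \<alpha>) \<Longrightarrow> (\<integral>\<^sup>+\<zeta>. (Iop \<phi> \<zeta>)\<^sup>2 \<partial>\<nu>) \<le> C * l2_norm_sq \<phi>"
  shows "emeasure \<nu> (\<Union>\<alpha>\<in>E. Sset \<alpha>) / Cap (\<Union>\<alpha>\<in>E. bdSset \<alpha>) \<le> ennreal ((144/7)\<^sup>2) * C"
proof -
  let ?U = "\<Union>\<alpha>\<in>E. Sset \<alpha>" and ?K = "ennreal ((144/7)\<^sup>2)"
  let ?cap = "Cap (\<Union>\<alpha>\<in>E. bdSset \<alpha>)"
  have U: "?U \<in> sets \<nu>" unfolding sets using E(1) by (intro sets.finite_UN Sset_borel) auto
  have main: "emeasure \<nu> ?U \<le> ?K * C * l2_norm_sq \<phi>"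
    if \<phi>: "\<And>\<alpha>. 0 \<le> \<phi> \<alpha>" and I: "\<And>\<zeta>. \<zeta> \<in> (\<Union>\<alpha>\<in>E. bdSset \<alpha>) \<Longrightarrow> 1 \<le> Iop \<phi> \<zeta>"
      and fin: "l2_norm_sq \<phi> < top" for \<phi>
  proof -
    obtain \<psi> where \<psi>: "\<And>\<alpha>. 0 \<le> \<psi> \<alpha>" "l2_norm_sq \<psi> \<le> ?K * l2_norm_sq \<phi>"
      "\<And>a b M. (a, b) \<in> E \<Longrightarrow> a \<in> tree_upto M \<Longrightarrow> b \<in> tree_upto M \<Longrightarrow> 1 \<le> hardy (tree_upto M) (curry \<psi>) a b"
      by (rule transfer_to_interior[OF \<phi> fin, of E]) (use I in auto)
    have "1 \<le> Iop \<psi> \<zeta>" if \<zeta>U: "\<zeta> \<in> ?U" for \<zeta>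
    proof -
      obtain x y where \<zeta>: "\<zeta> = (x, y)" by (cases \<zeta>)
      obtain \<alpha> where \<alpha>: "\<alpha> \<in> E" "(x, y) \<in> Sset \<alpha>" using \<zeta>U unfolding \<zeta> by blast
      obtain a b where "\<alpha> = (a, b)" by (cases \<alpha>)
      with \<alpha> have ab: "(a, b) \<in> E" and xy: "x \<le> Vert a" "y \<le> Vert b" by (simp_all add: Sset_Times)
      define M where "M = max (length a) (length b)"
      have M: "a \<in> tree_upto M" "b \<in> tree_upto M" by (auto simp: tree_upto_def M_def)
      have "1 \<le> hardy (tree_upto M) (curry \<psi>) a b" by (rule \<psi>(3)[OF ab M])
      also have "\<dots> \<le> hardy (tree_upto M) (curry \<psi>) (trunc M x) (trunc M y)"
        using \<psi>(1) xy M by (intro hardy_prefix) (auto simp: le_Vert_iff_trunc)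
      finally have "1 \<le> ennreal (hardy (tree_upto M) (curry \<psi>) (trunc M x) (trunc M y))" by simp
      also have "\<dots> \<le> Iop \<psi> \<zeta>"
        unfolding \<zeta> Iop_eq[of \<psi>, OF \<psi>(1)] by (rule SUP_upper) simp
      finally show ?thesis .
    qed
    then have "indicator ?U \<zeta> \<le> (Iop \<psi> \<zeta>)\<^sup>2" for \<zeta>
      using power_mono[of 1 "Iop \<psi> \<zeta>" 2] by (auto simp: indicator_def)
    then have "(\<integral>\<^sup>+\<zeta>. indicator ?U \<zeta> \<partial>\<nu>) \<le> (\<integral>\<^sup>+\<zeta>. (Iop \<psi> \<zeta>)\<^sup>2 \<partial>\<nu>)"
      by (intro nn_integral_mono)
    also have "\<dots> \<le> C * l2_norm_sq \<psi>" by (rule C[OF \<psi>(1)])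
    also have "\<dots> \<le> C * (?K * l2_norm_sq \<phi>)" by (intro mult_left_mono \<psi>(2)) auto
    finally show ?thesis using U by (simp add: mult_ac)
  qed
  have pos: "0 < ?cap" using E(2) Cap_pos by blast
  \<comment> \<open>In the first two cases one side of the claim is trivial because of infinite values.\<close>
  consider "?cap = top" | "?K * C = top" | "?cap < top" "?K * C < top"
    using less_top by blast
  then show ?thesis
  proof cases
    case 3
    have "emeasure \<nu> ?U \<le> ?cap * (?K * C)"
    proof (cases "?K * C = 0")
      case True
      obtain \<phi> where \<phi>: "\<forall>\<alpha>. 0 \<le> \<phi> \<alpha>" "\<forall>\<zeta>\<in>(\<Union>\<alpha>\<in>E. bdSset \<alpha>). 1 \<le> Iop \<phi> \<zeta>" "l2_norm_sq \<phi> < top"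
        using 3(1) unfolding Cap_def INF_less_iff by auto
      show ?thesis using main[of \<phi>] \<phi> unfolding True by auto
    next
      case False
      have "emeasure \<nu> ?U / (?K * C) \<le> l2_norm_sq \<phi>"
        if \<phi>: "\<forall>\<alpha>. 0 \<le> \<phi> \<alpha>" "\<forall>\<zeta>\<in>(\<Union>\<alpha>\<in>E. bdSset \<alpha>). 1 \<le> Iop \<phi> \<zeta>" for \<phi>
      proof (cases "l2_norm_sq \<phi> < top")
        case True
        show ?thesis
          by (rule divide_le_posI_ennreal) (use False main[of \<phi>] \<phi> True in \<open>auto simp: zero_less_iff_neq_zero\<close>)
      qed (simp add: not_less top_unique)
      then have "emeasure \<nu> ?U / (?K * C) \<le> ?cap"
        unfolding Cap_def by (intro INF_greatest) auto
      then have "emeasure \<nu> ?U / (?K * C) * (?K * C) \<le> ?cap * (?K * C)"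
        by (rule mult_right_mono) simp
      moreover have "emeasure \<nu> ?U / (?K * C) * (?K * C) = emeasure \<nu> ?U"
        using False 3(2) by (simp add: ennreal_divide_times)
      ultimately show ?thesis by simp
    qed
    then show ?thesis by (rule divide_le_posI_ennreal[OF pos])
  qed simp_all
qed

lemma cap_sup_le:
  fixes \<nu> :: "(tbar \<times> tbar) measure"
  assumes sets: "sets \<nu> = sets borel"
  shows "ennreal ((7/144)\<^sup>2) * cap_sup \<nu> \<le> I_norm_sq \<nu>"
  unfolding I_norm_sq_def
proof (rule Inf_greatest)
  fix C assume "C \<in> {C. \<forall>\<phi>. (\<forall>\<alpha>. 0 \<le> \<phi> \<alpha>) \<longrightarrow> (\<integral>\<^sup>+\<zeta>. (Iop \<phi> \<zeta>)\<^sup>2 \<partial>\<nu>) \<le> C * l2_norm_sq \<phi>}"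
  then have C: "(\<integral>\<^sup>+\<zeta>. (Iop \<phi> \<zeta>)\<^sup>2 \<partial>\<nu>) \<le> C * l2_norm_sq \<phi>" if "\<And>\<alpha>. 0 \<le> \<phi> \<alpha>" for \<phi>
    using that by blast
  have "cap_sup \<nu> \<le> ennreal ((144/7)\<^sup>2) * C"
    unfolding cap_sup_def
  proof (rule SUP_least, clarify)
    fix n :: nat and \<alpha> :: "nat \<Rightarrow> vertex \<times> vertex" assume "1 \<le> n"
    then show "emeasure \<nu> (\<Union>j\<in>{1..n}. Sset (\<alpha> j)) / Cap (\<Union>j\<in>{1..n}. bdSset (\<alpha> j)) \<le> ennreal ((144/7)\<^sup>2) * C"
      using quotient_le[OF sets _ _ C, of "\<alpha> ` {1..n}"] by simp
  qed
  then have "ennreal ((7/144)\<^sup>2) * cap_sup \<nu> \<le> ennreal ((7/144)\<^sup>2) * (ennreal ((144/7)\<^sup>2) * C)"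
    by (rule mult_left_mono) simp
  also have "\<dots> = C"
    by (simp add: power_divide flip: mult.assoc ennreal_mult)
  finally show "ennreal ((7/144)\<^sup>2) * cap_sup \<nu> \<le> C" .
qed

theorem theorem1p4:
  "\<exists>C1 C2 :: real. C1 > 0 \<and> C2 > 0 \<and>
     (\<forall>\<nu> :: (tbar \<times> tbar) measure. sets \<nu> = sets borel \<longrightarrow>
        ennreal C1 * cap_sup \<nu> \<le> I_norm_sq \<nu> \<and>
        I_norm_sq \<nu> \<le> ennreal C2 * cap_sup \<nu>)"
proof (intro exI conjI allI impI)
  fix \<nu> :: "(tbar \<times> tbar) measure" assume \<nu>: "sets \<nu> = sets borel"
  show "ennreal ((7/144)\<^sup>2) * cap_sup \<nu> \<le> I_norm_sq \<nu>" using \<nu> by (rule cap_sup_le)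
  show "I_norm_sq \<nu> \<le> ennreal 320 * cap_sup \<nu>" using I_norm_sq_le[OF \<nu>] by simp
qed simp_all

end
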